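(* The homogeneous $4$-Pythagoras number of binary octics satisfies $p_4(2,8)\in\{3,4\}$.
   Context: $\Sigma^4_{2,8}\subset\mathbb{R}[x,y]_8$ is the cone of real binary octics that are finite sums of fourth powers of forms in $\mathbb{R}[x,y]_2$. $p_4(2,8)$ is the minimal $\ell$ such that every $f\in\Sigma^4_{2,8}$ can be written as a sum of at most $\ell$ fourth powers of real binary quadratic forms. *)

theory Defs
  imports Complex_Main
begin

text \<open>A real binary quadratic form a x^2 + b x y + c y^2 is represented by its
coefficient triple (a,b,c); binary forms are identified with the polynomial
functions they define on R^2 (faithful over the infinite field R).\<close>

definition bquad :: "real \<times> real \<times> real \<Rightarrow> real \<Rightarrow> real \<Rightarrow> real" where
  "bquad q x y = (case q of (a, b, c) \<Rightarrow> a * x^2 + b * x * y + c * y^2)"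

definition sum4 :: "(real \<times> real \<times> real) list \<Rightarrow> real \<Rightarrow> real \<Rightarrow> real" where
  "sum4 qs = (\<lambda>x y. sum_list (map (\<lambda>q. (bquad q x y) ^ 4) qs))"

definition sum4_len :: "nat \<Rightarrow> (real \<Rightarrow> real \<Rightarrow> real) \<Rightarrow> bool" where
  "sum4_len l f = (\<exists>qs. length qs \<le> l \<and> f = sum4 qs)"

definition Sigma4_2_8 :: "(real \<Rightarrow> real \<Rightarrow> real) set" where
  "Sigma4_2_8 = {f. \<exists>qs. f = sum4 qs}"

definition p4_2_8 :: nat where
  "p4_2_8 = (LEAST l. \<forall>f\<in>Sigma4_2_8. sum4_len l f)"

end

theory Submission
  imports Defs "HOL-Analysis.Analysis"
begin

text \<open>
  Among all decompositions \<open>f = q1^4 + ... + qn^4\<close> choose one that maximises the sum of the squared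
  discriminants. Convex duality yields a nonnegative ternary quartic \<open>P\<close> in the coefficients \<open>(a, b, c)\<close>
  of a quadratic form, \<open>P q = L (q^4) - s (b^2 - 4 a c)^2\<close> with \<open>L\<close> linear on octics and \<open>s \<ge> 0\<close>, that
  vanishes at every \<open>q\<close> occurring in the decomposition. If these \<open>q\<close> lie in a plane, then \<open>f\<close> is a
  sum of fourth powers of binary linear forms in two fixed quadratics, and Gauss quadrature reduces it to
  three terms. Otherwise take three independent zeros of \<open>P\<close> as coordinate points. Then
  \<open>P (x, y, z) = T (y z, z x, x y)\<close> with \<open>T\<close> a positive semidefinite ternary quadratic form, so the zeros of
  \<open>P\<close> are at most four points, or lie on a line and one further point, or \<open>T\<close> has rank one. In the last case
  \<open>P\<close> is the square of a conic. The operator \<open>\<partial>\<^sub>b\<^sup>2 - \<partial>\<^sub>a \<partial>\<^sub>c\<close> annihilates every \<open>L (q^4)\<close>, and comparing its values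
  on the two expressions for \<open>P\<close> excludes this case.

  For the lower bound, \<open>x^4 (x^4 + y^4 + (x + y)^4)\<close> has a quartic factor of catalecticant rank three.
\<close>

section \<open>Duality\<close>

text \<open>\<open>t\<close> is the largest number for which the right-hand side is still in the cone generated by the
  values of \<open>F\<close>, and \<open>a\<close> separates this cone from the ray beyond.\<close>

lemma sum_fourth_powers_exposed:
  fixes F :: "'a::euclidean_space \<Rightarrow> 'b::euclidean_space"
  assumes cont: "continuous_on UNIV F"
    and hom: "\<And>t q. F (t *\<^sub>R q) = t ^ 4 *\<^sub>R F q"
    and pos: "\<And>q. q \<noteq> 0 \<Longrightarrow> 0 < l \<bullet> F q"
    and e: "e \<noteq> 0" "l \<bullet> e = 0"
    and qs: "0 < l \<bullet> sum_list (map F qs)"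
  obtains rs t a where "sum_list (map F rs) = sum_list (map F qs) - t *\<^sub>R e"
    and "a \<noteq> 0" and "0 \<le> a \<bullet> e" and "\<And>q. 0 \<le> a \<bullet> F q"
    and "\<And>q. q \<in> set rs \<Longrightarrow> a \<bullet> F q = 0"
proof -
  define x0 where "x0 = sum_list (map F qs)"
  define K where "K = range (\<lambda>rs. sum_list (map F rs))"
  have K_sum: "sum_list (map F rs) \<in> K" for rs by (auto simp: K_def)
  have F_K: "F q \<in> K" for q using K_sum[of "[q]"] by simp
  have K_add: "x + y \<in> K" if xy: "x \<in> K" "y \<in> K" for x y
  proof -
    obtain u v where "x = sum_list (map F u)" "y = sum_list (map F v)"
      using xy by (auto simp: K_def)
    then show ?thesis using K_sum[of "u @ v"] by simp
  qed
  have F0: "F 0 = 0" using hom[of 0 0] by simp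
  have K_scale: "t *\<^sub>R x \<in> K" if tx: "0 \<le> t" "x \<in> K" for t x
  proof -
    obtain u where u: "x = sum_list (map F u)" using tx by (auto simp: K_def)
    have "sum_list (map F (map (\<lambda>q. root 4 t *\<^sub>R q) u)) = t *\<^sub>R sum_list (map F u)"
      by (induction u) (use tx in \<open>auto simp: hom scaleR_add_right\<close>)
    then show ?thesis using K_sum u by metis
  qed
  have convK: "convex K" by (auto simp: convex_def intro: K_add K_scale)
  \<comment> \<open>The sphere is compact and \<open>l \<bullet> F q\<close> is positive on it, so
    rescaling to the slice \<open>l \<bullet> x = 1\<close> yields a compact convex base
    \<open>H\<close> of the cone \<open>K\<close>.\<close>
  define N where "N q = (1 / (l \<bullet> F q)) *\<^sub>R F q" for q
  define H where "H = convex hull (N ` sphere 0 1)"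
  have pos1: "0 < l \<bullet> F q" if "q \<in> sphere 0 1" for q using that by (intro pos) auto
  have "continuous_on (sphere 0 1) N"
    unfolding N_def using pos1
    by (intro continuous_intros continuous_on_subset[OF cont]) (auto simp: less_le)
  then have cH: "compact H" unfolding H_def
    by (intro compact_convex_hull compact_continuous_image) auto
  have lH: "l \<bullet> h = 1" if "h \<in> H" for h
  proof -
    have "H \<subseteq> {x. l \<bullet> x = 1}" unfolding H_def
      by (rule hull_minimal) (use pos1 in \<open>auto simp: N_def convex_hyperplane less_le\<close>)
    then show ?thesis using that by auto
  qed
  have "N q \<in> K" if "q \<in> sphere 0 1" for q
    unfolding N_def using F_K pos1[OF that] by (intro K_scale) auto
  then have HK: "H \<subseteq> K" unfolding H_def by (intro hull_minimal convK) auto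
  have FH: "\<exists>h\<in>H. F q = (l \<bullet> F q) *\<^sub>R h" if q: "q \<noteq> 0" for q
  proof -
    define u where "u = sgn q"
    have u: "u \<in> sphere 0 1" using q by (simp add: u_def norm_sgn)
    have "q = norm q *\<^sub>R u" using q by (simp add: u_def sgn_div_norm)
    then have Fq: "F q = norm q ^ 4 *\<^sub>R F u" by (metis hom)
    have "N u \<in> H" unfolding H_def using u by (intro hull_inc) auto
    moreover have "F q = (l \<bullet> F q) *\<^sub>R N u" using pos1[OF u] by (simp add: Fq N_def)
    ultimately show ?thesis by blast
  qed
  \<comment> \<open>Adding one term merges multiples \<open>d\<close> and \<open>c\<close> of two
    points of \<open>H\<close> into \<open>d + c\<close> times their weighted mean, so
    \<open>H\<close> generates all of \<open>K\<close>.\<close>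
  have KH: "\<exists>c\<ge>0. c = 0 \<and> sum_list (map F rs) = 0 \<or> c > 0 \<and> (\<exists>h\<in>H. sum_list (map F rs) = c *\<^sub>R h)" for rs
  proof (induction rs)
    case Nil then show ?case by auto
  next
    case (Cons q rs)
    show ?case
    proof (cases "q = 0")
      case True then show ?thesis using Cons F0 by simp
    next
      case False
      obtain h where h: "h \<in> H" "F q = (l \<bullet> F q) *\<^sub>R h" using FH[OF False] by blast
      define d where "d = l \<bullet> F q"
      have d: "d > 0" using pos[OF False] d_def by simp
      obtain c where c: "c = 0 \<and> sum_list (map F rs) = 0 \<or> c > 0 \<and> (\<exists>h\<in>H. sum_list (map F rs) = c *\<^sub>R h)"
        using Cons by blast
      then show ?thesis
      proof (elim disjE conjE bexE)
        assume "sum_list (map F rs) = 0"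
        then show ?thesis using h d d_def by (intro exI[of _ d]) auto
      next
        fix h' assume h': "h' \<in> H" "sum_list (map F rs) = c *\<^sub>R h'" "c > 0"
        have "(d / (d + c)) *\<^sub>R h + (c / (d + c)) *\<^sub>R h' \<in> H" unfolding H_def
          using h h' d by (intro convexD convex_convex_hull)
            (auto simp: H_def add_divide_distrib[symmetric])
        moreover have "sum_list (map F (q # rs)) = (d + c) *\<^sub>R ((d / (d + c)) *\<^sub>R h + (c / (d + c)) *\<^sub>R h')"
          using h h' d d_def by (simp add: scaleR_add_right)
        ultimately show ?thesis using d h'(3) by (intro exI[of _ "d + c"]) auto
      qed
    qed
  qed
  define c0 where "c0 = l \<bullet> x0"
  have c0: "c0 > 0" using qs by (simp add: c0_def x0_def)
  \<comment> \<open>Since \<open>l \<bullet> e = 0\<close>, the whole line stays in the slice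
    \<open>l \<bullet> x = c0\<close>. Division by \<open>c0\<close> turns membership in
    \<open>K\<close> into membership in the compact set \<open>H\<close>, so \<open>A\<close> is
    closed and bounded above.\<close>
  define A where "A = {t. (1 / c0) *\<^sub>R (x0 - t *\<^sub>R e) \<in> H}"
  have A_K: "t \<in> A \<longleftrightarrow> x0 - t *\<^sub>R e \<in> K" for t
  proof
    assume "t \<in> A"
    then have "(1 / c0) *\<^sub>R (x0 - t *\<^sub>R e) \<in> K" using HK unfolding A_def by blast
    from K_scale[OF _ this, of c0] show "x0 - t *\<^sub>R e \<in> K" using c0 by simp
  next
    assume "x0 - t *\<^sub>R e \<in> K"
    then obtain rs where rs: "x0 - t *\<^sub>R e = sum_list (map F rs)" unfolding K_def by blast
    have lx: "l \<bullet> (x0 - t *\<^sub>R e) = c0" by (simp add: inner_diff_right e c0_def)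
    obtain c h where "c > 0" "h \<in> H" "x0 - t *\<^sub>R e = c *\<^sub>R h"
      using KH[of rs] rs lx c0 by fastforce
    then show "t \<in> A" using lx lH c0 by (auto simp: A_def)
  qed
  have "closed A" unfolding A_def
  proof -
    have "closed ((\<lambda>t. (1 / c0) *\<^sub>R (x0 - t *\<^sub>R e)) -` H)"
      by (intro closed_vimage compact_imp_closed cH continuous_intros)
    then show "closed {t. (1 / c0) *\<^sub>R (x0 - t *\<^sub>R e) \<in> H}" by (simp add: vimage_def)
  qed
  moreover have "bdd_above A"
  proof -
    obtain B where B: "\<And>h. h \<in> H \<Longrightarrow> norm h \<le> B"
      using compact_imp_bounded[OF cH] unfolding bounded_iff by blast
    have "t \<le> (norm x0 + c0 * B) / norm e" if t: "t \<in> A" for t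
    proof -
      have "norm ((1 / c0) *\<^sub>R (x0 - t *\<^sub>R e)) \<le> B" using t B unfolding A_def by blast
      then have "norm (x0 - t *\<^sub>R e) \<le> c0 * B" using c0 by (simp add: pos_divide_le_eq mult.commute)
      moreover have "norm (t *\<^sub>R e) \<le> norm x0 + norm (x0 - t *\<^sub>R e)"
        using norm_triangle_sub[of "t *\<^sub>R e" x0] by (simp add: norm_minus_commute)
      ultimately have "\<bar>t\<bar> * norm e \<le> norm x0 + c0 * B" by simp
      moreover have "t * norm e \<le> \<bar>t\<bar> * norm e" by (intro mult_right_mono) auto
      ultimately have "t * norm e \<le> norm x0 + c0 * B" by linarith
      then show ?thesis using e(1) by (simp add: pos_le_divide_eq)
    qed
    then show ?thesis by (rule bdd_aboveI)
  qed
  moreover have "0 \<in> A" using K_sum by (simp add: A_K x0_def)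
  ultimately have SA: "Sup A \<in> A" by (intro closed_contains_Sup) auto
  define T where "T = (\<lambda>t. x0 - t *\<^sub>R e) ` {Sup A<..}"
  have T_K: "x0 - t *\<^sub>R e \<notin> K" if "t > Sup A" for t
    using that cSup_upper[OF _ \<open>bdd_above A\<close>] A_K by force
  have "convex T"
  proof -
    have "T = (+) x0 ` ((\<lambda>t. t *\<^sub>R (- e)) ` {Sup A<..})"
      unfolding T_def image_image by (intro image_cong) auto
    then show ?thesis
      by (simp only:) (intro convex_translation convex_scaled convex_real_interval)
  qed
  moreover have "T \<noteq> {}" unfolding T_def by auto
  moreover have "K \<inter> T = {}" using T_K unfolding T_def by auto
  moreover have "K \<noteq> {}" using F_K by auto
  ultimately obtain a b where a: "a \<noteq> 0" and T_b: "\<forall>x\<in>T. a \<bullet> x \<le> b" and K_b: "\<forall>x\<in>K. b \<le> a \<bullet> x"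
    using separating_hyperplane_sets[of T K] convK by (auto simp: Int_commute)
  have b0: "b \<le> 0" using K_b K_sum[of "[]"] by auto
  have a_K: "0 \<le> a \<bullet> x" if x: "x \<in> K" for x
  proof (rule ccontr)
    assume neg: "\<not> 0 \<le> a \<bullet> x"
    \<comment> \<open>This positive factor moves \<open>a \<bullet> x\<close> to
      \<open>b - 1\<close>, below the bound valid on \<open>K\<close>.\<close>
    define t where "t = (b - 1) / (a \<bullet> x)"
    have "b \<le> a \<bullet> (t *\<^sub>R x)" using K_b K_scale[OF _ x, of t] neg b0
      by (auto simp: t_def divide_nonpos_neg)
    also have "\<dots> = b - 1" using neg by (simp add: t_def)
    finally show False by simp
  qed
  have T_t: "a \<bullet> x0 - t * (a \<bullet> e) \<le> b" if "t > Sup A" for t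
    using T_b that unfolding T_def by (auto simp: inner_diff_right)
  have ae: "0 \<le> a \<bullet> e"
  proof (rule ccontr)
    assume neg: "\<not> 0 \<le> a \<bullet> e"
    \<comment> \<open>Far enough along the ray a negative \<open>a \<bullet> e\<close> pushes the
      functional to at least \<open>b + 1\<close>.\<close>
    define t where "t = max (Sup A + 1) ((a \<bullet> x0 - b - 1) / (a \<bullet> e))"
    have "t \<ge> (a \<bullet> x0 - b - 1) / (a \<bullet> e)" by (simp add: t_def)
    then have "t * (a \<bullet> e) \<le> a \<bullet> x0 - b - 1" using neg by (simp add: field_simps)
    moreover have "a \<bullet> x0 - t * (a \<bullet> e) \<le> b" by (rule T_t) (simp add: t_def)
    ultimately show False by simp
  qed
  obtain rs where rs: "x0 - Sup A *\<^sub>R e = sum_list (map F rs)"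
    using SA unfolding A_K K_def by blast
  \<comment> \<open>Letting \<open>t\<close> decrease to \<open>Sup A\<close> bounds the functional
    at the endpoint by \<open>b \<le> 0\<close>. The endpoint lies in \<open>K\<close>, hence is a
    sum of terms with nonnegative values, and all these values must vanish.\<close>
  have "a \<bullet> x0 - Sup A * (a \<bullet> e) \<le> b"
  proof (rule tendsto_upperbound)
    show "((\<lambda>t. a \<bullet> x0 - t * (a \<bullet> e)) \<longlongrightarrow> a \<bullet> x0 - Sup A * (a \<bullet> e)) (at_right (Sup A))"
      by (intro tendsto_intros)
    show "\<forall>\<^sub>F t in at_right (Sup A). a \<bullet> x0 - t * (a \<bullet> e) \<le> b"
      using T_t by (auto simp: eventually_at_right_field intro: exI[of _ "Sup A + 1"])
  qed auto
  then have z: "a \<bullet> sum_list (map F rs) \<le> 0"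
    using b0 rs[symmetric] by (simp add: inner_diff_right)
  have aF: "0 \<le> a \<bullet> F q" for q by (intro a_K F_K)
  have inner_sum: "a \<bullet> sum_list (map F us) = sum_list (map (\<lambda>q. a \<bullet> F q) us)" for us
    by (induction us) (auto simp: inner_add_right)
  have aF_rs: "a \<bullet> F q = 0" if q: "q \<in> set rs" for q
  proof -
    have "a \<bullet> F q \<le> sum_list (map (\<lambda>q. a \<bullet> F q) rs)"
      using q aF by (intro member_le_sum_list) auto
    then show ?thesis using z aF[of q] inner_sum[of rs] by linarith
  qed
  have "sum_list (map F rs) = sum_list (map F qs) - Sup A *\<^sub>R e" using rs by (simp only: x0_def)
  then show ?thesis using a ae aF aF_rs by (rule that)
qed

section \<open>Ternary quartics\<close>

definition quadratic3 :: "(real \<Rightarrow> real \<Rightarrow> real \<Rightarrow> real) \<Rightarrow> bool" where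
  "quadratic3 f \<longleftrightarrow> (\<exists>k :: nat \<Rightarrow> real. \<forall>x y z. f x y z =
     k 0 * x^2 + k 1 * y^2 + k 2 * z^2 + k 3 * (y*z) + k 4 * (z*x) + k 5 * (x*y))"

text \<open>The monomials are grouped as fourth powers, cubes times another variable, products of
  two squares, and monomials in all three variables. The first two groups are those that drop out
  when a nonnegative quartic vanishes at the coordinate points.\<close>

definition quartic3_eval :: "(nat \<Rightarrow> real) \<Rightarrow> real \<Rightarrow> real \<Rightarrow> real \<Rightarrow> real" where
  "quartic3_eval k x y z =
     k 0 * x^4 + k 1 * y^4 + k 2 * z^4
   + k 3 * (x^3*y) + k 4 * (x^3*z) + k 5 * (y^3*x) + k 6 * (y^3*z) + k 7 * (z^3*x) + k 8 * (z^3*y)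
   + k 9 * (y^2*z^2) + k 10 * (z^2*x^2) + k 11 * (x^2*y^2)
   + k 12 * (x^2*y*z) + k 13 * (x*y^2*z) + k 14 * (x*y*z^2)"

definition quartic3 :: "(real \<Rightarrow> real \<Rightarrow> real \<Rightarrow> real) \<Rightarrow> bool" where
  "quartic3 f \<longleftrightarrow> (\<exists>k. f = quartic3_eval k)"

lemma quadratic3_mult_linear:
  "quadratic3 (\<lambda>x y z. (x*a1 + y*a2 + z*a3) * (x*b1 + y*b2 + z*b3))"
  unfolding quadratic3_def
  by (rule exI[of _ "(!) [a1*b1, a2*b2, a3*b3, a2*b3+a3*b2, a3*b1+a1*b3, a1*b2+a2*b1]"])
    (simp add: algebra_simps power2_eq_square)

lemma quadratic3_add: "quadratic3 (\<lambda>x y z. f x y z + g x y z)" if fg: "quadratic3 f" "quadratic3 g"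
proof -
  obtain k m where "\<And>x y z. f x y z =
     k 0 * x^2 + k (1::nat) * y^2 + k 2 * z^2 + k 3 * (y * z) + k 4 * (z * x) + k 5 * (x * y)"
    "\<And>x y z. g x y z =
     m 0 * x^2 + m (1::nat) * y^2 + m 2 * z^2 + m 3 * (y * z) + m 4 * (z * x) + m 5 * (x * y)"
    using fg unfolding quadratic3_def by auto
  then show ?thesis unfolding quadratic3_def
    by (intro exI[of _ "\<lambda>i. k i + m i"]) (simp add: algebra_simps)
qed

lemma quadratic3_cmult: "quadratic3 (\<lambda>x y z. c * f x y z)" if f: "quadratic3 f"
proof -
  obtain k where "\<And>x y z. f x y z =
     k 0 * x^2 + k (1::nat) * y^2 + k 2 * z^2 + k 3 * (y * z) + k 4 * (z * x) + k 5 * (x * y)"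
    using f unfolding quadratic3_def by auto
  then show ?thesis unfolding quadratic3_def
    by (intro exI[of _ "\<lambda>i. c * k i"]) (simp add: algebra_simps)
qed

lemma quartic3_mult: "quartic3 (\<lambda>x y z. f x y z * g x y z)" if fg: "quadratic3 f" "quadratic3 g"
proof -
  obtain k :: "nat \<Rightarrow> real" where k: "\<And>x y z. f x y z =
     k 0 * x^2 + k 1 * y^2 + k 2 * z^2 + k 3 * (y*z) + k 4 * (z*x) + k 5 * (x*y)"
    using fg(1) unfolding quadratic3_def by auto
  obtain m :: "nat \<Rightarrow> real" where m: "\<And>x y z. g x y z =
     m 0 * x^2 + m 1 * y^2 + m 2 * z^2 + m 3 * (y*z) + m 4 * (z*x) + m 5 * (x*y)"
    using fg(2) unfolding quadratic3_def by auto
  show ?thesis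
    unfolding quartic3_def quartic3_eval_def fun_eq_iff k m
    by (rule exI[of _ "(!) [k 0 * m 0, k 1 * m 1, k 2 * m 2,
          k 0 * m 5 + k 5 * m 0, k 0 * m 4 + k 4 * m 0, k 1 * m 5 + k 5 * m 1,
          k 1 * m 3 + k 3 * m 1, k 2 * m 4 + k 4 * m 2, k 2 * m 3 + k 3 * m 2,
          k 1 * m 2 + k 2 * m 1 + k 3 * m 3, k 2 * m 0 + k 0 * m 2 + k 4 * m 4,
          k 0 * m 1 + k 1 * m 0 + k 5 * m 5,
          k 0 * m 3 + k 3 * m 0 + k 4 * m 5 + k 5 * m 4,
          k 1 * m 4 + k 4 * m 1 + k 3 * m 5 + k 5 * m 3,
          k 2 * m 5 + k 5 * m 2 + k 3 * m 4 + k 4 * m 3]"])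
      (simp add: field_simps power2_eq_square power3_eq_cube power4_eq_xxxx)
qed

lemma quartic3_add: "quartic3 (\<lambda>x y z. f x y z + g x y z)" if fg: "quartic3 f" "quartic3 g"
proof -
  obtain k m where "f = quartic3_eval k" "g = quartic3_eval m"
    using fg unfolding quartic3_def by auto
  then show ?thesis unfolding quartic3_def quartic3_eval_def fun_eq_iff
    by (intro exI[of _ "\<lambda>i. k i + m i"]) (simp add: algebra_simps)
qed

lemma quartic3_cmult: "quartic3 (\<lambda>x y z. c * f x y z)" if f: "quartic3 f"
proof -
  obtain k where "f = quartic3_eval k"
    using f unfolding quartic3_def by auto
  then show ?thesis unfolding quartic3_def quartic3_eval_def fun_eq_iff
    by (intro exI[of _ "\<lambda>i. c * k i"]) (simp add: algebra_simps)
qed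

lemma quartic3_linear_prod:
  "quartic3 (\<lambda>x y z. (x*a1 + y*a2 + z*a3) * (x*b1 + y*b2 + z*b3) * ((x*c1 + y*c2 + z*c3) * (x*d1 + y*d2 + z*d3)))"
  by (rule quartic3_mult[OF quadratic3_mult_linear quadratic3_mult_linear])

text \<open>Serves to rewrite the dual quartic in a basis made of three of its zeros.\<close>

lemma quartic3_subst: "quartic3 (\<lambda>x y z. quartic3_eval k (x*a1 + y*a2 + z*a3) (x*b1 + y*b2 + z*b3) (x*c1 + y*c2 + z*c3))"
  unfolding quartic3_eval_def power2_eq_square power3_eq_cube power4_eq_xxxx mult.assoc
  by (intro quartic3_add quartic3_cmult quartic3_linear_prod[unfolded mult.assoc])

text \<open>The axes determine the fourth powers, points of the coordinate planes the monomials in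
  two variables, and three points with entries \<open>1\<close> and \<open>-1\<close> the
  rest.\<close>

lemma quartic3_eval_eq_0:
  assumes 0: "\<And>x y z. quartic3_eval k x y z = 0"
  shows "\<forall>i<15. k i = 0"
proof -
  note e = 0[unfolded quartic3_eval_def]
  have a: "k 0 = 0" "k 1 = 0" "k 2 = 0"
    using e[of 1 0 0] e[of 0 1 0] e[of 0 0 1] by simp_all
  have b: "k 11 = 0" "k 3 + k 5 = 0" "4 * k 3 + k 5 = 0"
    using e[of 1 1 0] e[of 1 "-1" 0] e[of 2 1 0] a by simp_all
  have c: "k 10 = 0" "k 4 + k 7 = 0" "4 * k 4 + k 7 = 0"
    using e[of 1 0 1] e[of 1 0 "-1"] e[of 2 0 1] a by simp_all
  have d: "k 9 = 0" "k 6 + k 8 = 0" "4 * k 6 + k 8 = 0"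
    using e[of 0 1 1] e[of 0 1 "-1"] e[of 0 2 1] a by simp_all
  have z: "k 3 = 0" "k 5 = 0" "k 4 = 0" "k 7 = 0" "k 6 = 0" "k 8 = 0" using b c d by linarith+
  have "k 12 + k 13 + k 14 = 0" "k 13 + k 14 = k 12" "k 12 + k 14 = k 13"
    using e[of 1 1 1] e[of "-1" 1 1] e[of 1 "-1" 1] a b c d z by simp_all
  then have "k 12 = 0" "k 13 = 0" "k 14 = 0" by linarith+
  then show ?thesis using a b(1) c(1) d(1) z
    by (simp add: less_Suc_eq numeral_eq_Suc)
qed

section \<open>Nonnegative quartics vanishing at the coordinate points\<close>

lemma nonneg_cubic_linear_coeff_0:
  fixes \<alpha> \<beta> \<gamma> :: real
  assumes "\<And>t. 0 \<le> \<alpha> * t + \<beta> * t^2 + \<gamma> * t^3"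
  shows "\<alpha> = 0"
\<comment> \<open>The polynomial is nonnegative and vanishes at \<open>0\<close>, so
  \<open>0\<close> is a minimum and the derivative \<alpha> there is zero.\<close>
proof (rule DERIV_local_min)
  show "((\<lambda>t. \<alpha> * t + \<beta> * t^2 + \<gamma> * t^3) has_real_derivative \<alpha>) (at 0)"
    by (auto intro!: derivative_eq_intros)
qed (use assms in \<open>auto intro: zero_less_one\<close>)

text \<open>Along each line from one coordinate point to another the quartic has a minimum at the
  starting point, which removes every cube times another variable. The six surviving monomials are
  the pairwise products of \<open>y*z\<close>, \<open>z*x\<close>, \<open>x*y\<close>.\<close>

lemma nonneg_quartic3_three_zeros:
  assumes k: "\<And>x y z. P x y z = quartic3_eval k x y z"
    and nn: "\<And>x y z. 0 \<le> P x y z"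
    and z: "P 1 0 0 = 0" "P 0 1 0 = 0" "P 0 0 1 = 0"
  obtains A B C D E G where "\<And>x y z. P x y z = A * (y*z)^2 + B * (z*x)^2 + C * (x*y)^2
    + 2 * D * (z*x) * (x*y) + 2 * E * (y*z) * (x*y) + 2 * G * (y*z) * (z*x)"
proof -
  note e = k[unfolded quartic3_eval_def]
  have k0: "k 0 = 0" "k (Suc 0) = 0" "k 2 = 0" using z by (simp_all add: e)
  have "k 3 = 0" by (rule nonneg_cubic_linear_coeff_0[of _ "k 11" "k 5"])
      (use nn[of 1 t 0 for t] in \<open>simp add: e k0 algebra_simps\<close>)
  moreover have "k 4 = 0" by (rule nonneg_cubic_linear_coeff_0[of _ "k 10" "k 7"])
      (use nn[of 1 0 t for t] in \<open>simp add: e k0 algebra_simps\<close>)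
  moreover have "k 5 = 0" by (rule nonneg_cubic_linear_coeff_0[of _ "k 11" "k 3"])
      (use nn[of t 1 0 for t] in \<open>simp add: e k0 algebra_simps\<close>)
  moreover have "k 6 = 0" by (rule nonneg_cubic_linear_coeff_0[of _ "k 9" "k 8"])
      (use nn[of 0 1 t for t] in \<open>simp add: e k0 algebra_simps\<close>)
  moreover have "k 7 = 0" by (rule nonneg_cubic_linear_coeff_0[of _ "k 10" "k 4"])
      (use nn[of t 0 1 for t] in \<open>simp add: e k0 algebra_simps\<close>)
  moreover have "k 8 = 0" by (rule nonneg_cubic_linear_coeff_0[of _ "k 9" "k 6"])
      (use nn[of 0 t 1 for t] in \<open>simp add: e k0 algebra_simps\<close>)
  ultimately show ?thesis
    by (intro that[of "k 9" "k 10" "k 11" "k 12 / 2" "k 13 / 2" "k 14 / 2"])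
      (simp add: e k0 power2_eq_square algebra_simps)
qed

text \<open>The hypotheses on \<open>p, ..., n\<close> say that the square of the conic with symmetric matrix
  \<open>((p, q, t), (q, r, u), (t, u, n))\<close> has the same image under \<open>\<partial>\<^sub>b\<^sup>2 - \<partial>\<^sub>a \<partial>\<^sub>c\<close> as \<open>- s (b^2 - 4 a c)^2\<close>.
  The conclusion is that all \<open>2 \<times> 2\<close> minors vanish.\<close>

lemma conic_square_relations_rank_one:
  fixes p q r t u n s :: real
  assumes "0 \<le> s"
    and 1: "3 * p * t = p * r + 2 * q^2"
    and 2: "p * u + 2 * q * t = 3 * q * r"
    and 3: "q * n + 2 * u * t = 3 * u * r"
    and 4: "3 * n * t = n * r + 2 * u^2"
    and 5: "p * n + 2 * t^2 = 3 * r^2 - 5 * s"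
    and 6: "t * r + 2 * q * u = 3 * r^2 + 5 * s"
  shows "p * r = q^2 \<and> p * t = q^2 \<and> p * n = t^2 \<and> r * n = u^2 \<and> t * n = u^2 \<and> p * u = q * t \<and> q * u = t * r
     \<and> q * n = u * t \<and> q * u = t^2 \<and> r = t"
proof -
  define w where "w = 3 * t - r"
  have pw: "p * w = 2 * q^2" and vw: "n * w = 2 * u^2" using 1 4 by (simp_all add: w_def algebra_simps)
  have r2: "0 \<le> r^2" "0 \<le> t^2" by simp_all
  show ?thesis
  proof (cases "q = 0 \<and> u = 0")
    case True
    show ?thesis
    proof (cases "w = 0")
      case True
      then have "r = 3 * t" by (simp add: w_def)
      then have "24 * t^2 + 5 * s = 0" using 6 \<open>q = 0 \<and> u = 0\<close> by (simp add: power2_eq_square algebra_simps)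
      then have "t^2 = 0" using assms(1) r2 by linarith
      then show ?thesis using \<open>r = 3 * t\<close> \<open>q = 0 \<and> u = 0\<close> 5 6 by simp
    next
      case False
      then have "p = 0" "n = 0" using pw vw True by auto
      then have a: "2 * t^2 = 3 * r^2 - 5 * s" "t * r = 3 * r^2 + 5 * s" using 5 6 True by auto
      \<comment> \<open>Adding the two equations eliminates \<open>s\<close>, and the resulting
        binary form in \<open>t\<close>, \<open>r\<close> splits.\<close>
      then have "(2 * t - 3 * r) * (t + 2 * r) = 0" by (simp add: power2_eq_square algebra_simps)
      then have "2 * t = 3 * r \<or> t = -2 * r" by auto
      then have "r^2 = 0"
      proof
        assume "2 * t = 3 * r"
        then have "2 * (t * r) = 3 * r^2" by (simp add: power2_eq_square)
        then show ?thesis using a(2) assms(1) r2 by linarith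
      next
        assume "t = -2 * r"
        then have "t * r = -2 * r^2" by (simp add: power2_eq_square)
        then show ?thesis using a(2) assms(1) r2 by linarith
      qed
      then have "r = 0" "t^2 = 0" using a(1) assms(1) r2(2) by (simp, linarith)
      then show ?thesis using False by (simp add: w_def)
    qed
  next
    case False
    \<comment> \<open>Multiplying relations 2 and 3 by \<open>w\<close> and inserting
      \<open>pw\<close>, \<open>vw\<close> leaves a common factor \<open>q\<close> or
      \<open>u\<close>, one of which can be cancelled. With relation 6 this gives
      \<open>5 * s + 6*(t-r)^2 = 0\<close>, a sum of two nonnegative terms.\<close>
    have "q * (w * (3 * r - 2 * t)) = q * (2 * q * u)"
    proof -
      have "q * (3 * r - 2 * t) = p * u" using 2 by (simp add: algebra_simps)
      then have "q * (w * (3 * r - 2 * t)) = (p * w)*u" by (metis mult.commute mult.left_commute)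
      then show ?thesis by (simp add: pw power2_eq_square mult.assoc)
    qed
    moreover have "u * (w * (3 * r - 2 * t)) = u * (2 * q * u)"
    proof -
      have "u * (3 * r - 2 * t) = q * n" using 3 by (simp add: algebra_simps)
      then have "u * (w * (3 * r - 2 * t)) = (n * w)*q" by (metis mult.commute mult.left_commute)
      then show ?thesis by (simp add: vw power2_eq_square mult_ac)
    qed
    ultimately have qu: "w * (3 * r - 2 * t) = 2 * q * u" using False by auto
    then have "5 * s + 6*(t-r)^2 = 0" using 6 by (simp add: w_def power2_eq_square algebra_simps)
    moreover have "0 \<le> (t-r)^2" by simp
    ultimately have s: "s = 0" "(t-r)^2 = 0" using assms(1) by linarith+
    then have tr: "r = t" by simp
    then have "q * u = t^2" using qu by (simp add: w_def power2_eq_square)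
    then show ?thesis using 1 2 3 4 5 tr s by (auto simp: power2_eq_square algebra_simps)
  qed
qed

text \<open>Completing the square: if the determinant \<open>A * C - B^2\<close> is zero, the square
  of one linear form remains; if it is positive, the form is definite.\<close>

lemma nonneg_binary_quadratic:
  fixes A B C :: real
  assumes nn: "\<And>x y. 0 \<le> A * x^2 + 2 * B * x * y + C * y^2"
  shows "(\<exists>a b. \<forall>x y. A * x^2 + 2 * B * x * y + C * y^2 = (a * x + b * y)^2)
       \<or> (\<forall>x y. A * x^2 + 2 * B * x * y + C * y^2 = 0 \<longrightarrow> x = 0 \<and> y = 0)"
proof -
  have A: "0 \<le> A" and C: "0 \<le> C" using nn[of 1 0] nn[of 0 1] by simp_all
  show ?thesis
  proof (cases "A = 0")
    case True
    have "B = 0"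
    proof (rule ccontr)
      assume "B \<noteq> 0"
      \<comment> \<open>At this point the form has value \<open>-1\<close>.\<close>
      then show False using nn[of "-(C + 1) / (2 * B)" 1] True by simp
    qed
    then have "A * x^2 + 2 * B * x * y + C * y^2 = (0 * x + sqrt C * y)^2" for x y
      using C True by (simp add: power_mult_distrib)
    then show ?thesis by blast
  next
    case False
    have sq: "A * (A * x^2 + 2 * B * x * y + C * y^2) = (A * x + B * y)^2 + (A * C - B^2) * y^2" for x y
      by (simp add: power2_eq_square algebra_simps)
    have "0 \<le> A * (A * C - B^2)" using nn[of "-B" A] False A
      by (simp add: power2_eq_square algebra_simps)
    then have disc: "0 \<le> A * C - B^2" using A False by (simp add: zero_le_mult_iff)
    show ?thesis
    proof (cases "A * C - B^2 = 0")
      case True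
      have "A * x^2 + 2 * B * x * y + C * y^2 = (sqrt A * x + B / sqrt A * y)^2" for x y
      proof -
        have "(sqrt A * x + B / sqrt A * y)^2 = A * x^2 + 2 * B * x * y + B^2 / A * y^2"
          using A False by (simp add: power2_sum power_mult_distrib power_divide)
        moreover have "B^2 / A = C" using True False by (simp add: field_simps)
        ultimately show ?thesis by simp
      qed
      then show ?thesis by blast
    next
      case neq: False
      have "x = 0 \<and> y = 0" if z: "A * x^2 + 2 * B * x * y + C * y^2 = 0" for x y
      proof -
        have "(A * x + B * y)^2 + (A * C - B^2) * y^2 = 0" using sq[of x y] z by simp
        moreover have "0 \<le> (A * C - B^2) * y^2" "0 \<le> (A * x + B * y)^2" using disc by auto
        ultimately have "(A * C - B^2) * y^2 = 0" "(A * x + B * y)^2 = 0" by linarith+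
        then show ?thesis using neq False by auto
      qed
      then show ?thesis by blast
    qed
  qed
qed

section \<open>Semidefinite ternary forms composed with the Cremona map\<close>

definition ternary_form :: "real \<Rightarrow> real \<Rightarrow> real \<Rightarrow> real \<Rightarrow> real \<Rightarrow> real \<Rightarrow> real \<Rightarrow> real \<Rightarrow> real \<Rightarrow> real" where
  "ternary_form A B C D E G u v w =
     A * u^2 + B * v^2 + C * w^2 + 2 * D * v * w + 2 * E * u * w + 2 * G * u * v"

text \<open>The map \<open>(x, y, z)\<close> to \<open>(y*z, z*x, x*y)\<close> sends
  \<open>(v*w, u*w, u*v)\<close> to \<open>u*v*w\<close> times \<open>(u, v, w)\<close>, so it
  reaches every direction with nonzero coordinates. The other directions follow by
  continuity.\<close>

lemma cremona_nonneg:
  assumes nn: "\<And>x y z. 0 \<le> ternary_form A B C D E G (y*z) (z*x) (x*y)"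
  shows "0 \<le> ternary_form A B C D E G u v w"
proof -
  have dense: "0 \<le> ternary_form A B C D E G u v w" if uvw: "u \<noteq> 0" "v \<noteq> 0" "w \<noteq> 0" for u v w
  proof -
    have "0 \<le> ternary_form A B C D E G ((u * w) * (u * v)) ((u * v) * (v * w)) ((v * w) * (u * w))" by (rule nn)
    also have "\<dots> = (u * v * w)^2 * ternary_form A B C D E G u v w"
      by (simp add: ternary_form_def power2_eq_square algebra_simps)
    finally show ?thesis using uvw by (simp add: zero_le_mult_iff)
  qed
  have nz: "\<forall>\<^sub>F e in at_right 0. c + e \<noteq> 0" for c :: real
  proof (cases "c < 0")
    case True
    then show ?thesis by (auto simp: eventually_at_right_field intro!: exI[of _ "-c"])
  next
    case False
    then show ?thesis by (auto simp: eventually_at_right_field intro!: exI[of _ 1])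
  qed
  have "((\<lambda>e. ternary_form A B C D E G (u + e) (v + e) (w + e)) \<longlongrightarrow>
      ternary_form A B C D E G (u + 0) (v + 0) (w + 0)) (at_right 0)"
    unfolding ternary_form_def by (intro tendsto_intros)
  moreover have "\<forall>\<^sub>F e in at_right 0. 0 \<le> ternary_form A B C D E G (u + e) (v + e) (w + e)"
    using nz[of u] nz[of v] nz[of w] by eventually_elim (rule dense)
  ultimately have "0 \<le> ternary_form A B C D E G (u + 0) (v + 0) (w + 0)"
    by (rule tendsto_lowerbound) simp
  then show ?thesis by simp
qed

text \<open>A zero diagonal entry of a semidefinite matrix kills its row, so \<open>x^2\<close>
  splits off and a binary form in \<open>z\<close>, \<open>y\<close> remains, either a square or
  definite.\<close>

lemma cremona_zeros_degenerate:
  assumes nn: "\<And>u v w. 0 \<le> ternary_form A B C D E G u v w" and A: "A = 0"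
  shows "(\<exists>l m n. \<forall>x y z. ternary_form A B C D E G (y*z) (z*x) (x*y) = (l * (y*z) + m * (z*x) + n * (x*y))^2)
    \<or> (\<forall>x y z. ternary_form A B C D E G (y*z) (z*x) (x*y) = 0 \<longrightarrow> x = 0 \<or> y = 0 \<and> z = 0)"
proof -
  have E: "E = 0"
  proof (rule ccontr)
    assume "E \<noteq> 0"
    then show False using nn[of "-(C + 1) / (2 * E)" 0 1] A by (simp add: ternary_form_def)
  qed
  have G: "G = 0"
  proof (rule ccontr)
    assume "G \<noteq> 0"
    then show False using nn[of "-(B + 1) / (2 * G)" 1 0] A by (simp add: ternary_form_def)
  qed
  have T: "ternary_form A B C D E G u v w = B * v^2 + 2 * D * v * w + C * w^2" for u v w
    by (simp add: ternary_form_def A E G)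
  have fact: "ternary_form A B C D E G (y*z) (z*x) (x*y) = x^2 * (B * z^2 + 2 * D * z * y + C * y^2)" for x y z
    unfolding T by (simp add: power2_eq_square algebra_simps)
  have "0 \<le> B * v^2 + 2 * D * v * w + C * w^2" for v w using nn[of 0 v w] unfolding T .
  from nonneg_binary_quadratic[OF this] show ?thesis
  proof (elim disjE exE)
    fix a b assume ab: "\<forall>x y. B * x^2 + 2 * D * x * y + C * y^2 = (a * x + b * y)^2"
    have sq: "ternary_form A B C D E G (y*z) (z*x) (x*y) = (0 * (y*z) + a * (z*x) + b * (x*y))^2" for x y z
      unfolding T ab[rule_format] by simp
    show ?thesis by (intro disjI1 exI allI) (rule sq)
  next
    assume *: "\<forall>x y. B * x^2 + 2 * D * x * y + C * y^2 = 0 \<longrightarrow> x = 0 \<and> y = 0"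
    have "x = 0 \<or> y = 0 \<and> z = 0" if "ternary_form A B C D E G (y*z) (z*x) (x*y) = 0" for x y z
      using that *[rule_format, of z y] unfolding fact by (auto simp: mult.commute)
    then show ?thesis by blast
  qed
qed

text \<open>A zero on the triangle \<open>x*y*z = 0\<close> is a vertex because no diagonal
  coefficient vanishes. Off the triangle it comes from the kernel of the form: rank one means a
  square, rank two leaves at most one further point, and rank three leaves none.\<close>

lemma cremona_zeros_nondegenerate:
  assumes nn: "\<And>u v w. 0 \<le> ternary_form A B C D E G u v w"
    and nz: "A \<noteq> 0" "B \<noteq> 0" "C \<noteq> 0"
  shows "(\<exists>l m n. \<forall>x y z. ternary_form A B C D E G (y*z) (z*x) (x*y) = (l * (y*z) + m * (z*x) + n * (x*y))^2)
    \<or> (\<exists>a b c. \<forall>x y z. ternary_form A B C D E G (y*z) (z*x) (x*y) = 0 \<longrightarrow>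
         (y = 0 \<and> z = 0) \<or> (z = 0 \<and> x = 0) \<or> (x = 0 \<and> y = 0)
         \<or> (\<exists>t. x = t * a \<and> y = t * b \<and> z = t * c))"
proof -
  let ?T = "ternary_form A B C D E G"
  have A: "0 < A" using nn[of 1 0 0] nz by (simp add: ternary_form_def)
  \<comment> \<open>\<open>A\<close> times the Schur complement of the entry
    \<open>A\<close>.\<close>
  define T2 where "T2 v w = (A * B - G^2) * v^2 + 2 * (A * D - E * G) * v * w + (A * C - E^2) * w^2" for v w
  have sq: "A * ?T u v w = (A * u + G * v + E * w)^2 + T2 v w" for u v w
    by (simp add: ternary_form_def T2_def power2_eq_square algebra_simps)
  have T2_nn: "0 \<le> T2 v w" for v w
  proof -
    have "A * ?T (-(G * v + E * w) / A) v w = T2 v w" unfolding sq using A by simp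
    then show ?thesis using nn A by (metis less_imp_le mult_nonneg_nonneg)
  qed
  have coord: "(y = 0 \<and> z = 0) \<or> (z = 0 \<and> x = 0) \<or> (x = 0 \<and> y = 0)"
    if "?T (y*z) (z*x) (x*y) = 0" "x = 0 \<or> y = 0 \<or> z = 0" for x y z
    using that nz by (auto simp: ternary_form_def)
  from nonneg_binary_quadratic[OF T2_nn[unfolded T2_def]] show ?thesis
  proof (elim disjE exE)
    fix a b assume "\<forall>x y. (A * B - G^2) * x^2 + 2 * (A * D - E * G) * x * y + (A * C - E^2) * y^2
        = (a * x + b * y)^2"
    then have T2: "T2 v w = (a * v + b * w)^2" for v w by (simp add: T2_def)
    show ?thesis
    proof (cases "a = 0 \<and> b = 0")
      case True
      have sqr: "?T u v w = ((A / sqrt A) * u + (G / sqrt A) * v + (E / sqrt A) * w)^2" for u v w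
      proof -
        have "((A / sqrt A) * u + (G / sqrt A) * v + (E / sqrt A) * w)^2 = ((A * u + G * v + E * w) / sqrt A)^2"
          by (simp add: add_divide_distrib)
        also have "\<dots> = A * ?T u v w / A" unfolding sq T2 using True A by (simp add: power_divide)
        finally show ?thesis using A by simp
      qed
      show ?thesis by (intro disjI1 exI allI) (rule sqr)
    next
      case False
      define k where "k = - (G * b - E * a)"
      have ker: "\<exists>s. A * u = s * k \<and> v = s * b \<and> w = - s * a" if T0: "?T u v w = 0" for u v w
      proof -
        have "(A * u + G * v + E * w)^2 + (a * v + b * w)^2 = 0" using sq[of u v w] T0 T2 by simp
        then have l: "A * u + G * v + E * w = 0" "a * v + b * w = 0"
          by (simp_all add: sum_power2_eq_zero_iff)
        show ?thesis
        proof (cases "b = 0")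
          case True
          then have "v = 0" using l False by simp
          then show ?thesis using l True False by (intro exI[of _ "- w / a"]) (simp add: k_def field_simps)
        next
          case b: False
          have w: "w = - (v / b) * a" using l b by (simp add: field_simps)
          have "A * u = v / b * k" using l(1) b unfolding w k_def by (simp add: field_simps)
          then show ?thesis using w b by (intro exI[of _ "v / b"]) simp
        qed
      qed
      text \<open>The Cremona involution inverts coordinates off the triangle \<open>x y z = 0\<close>, so the kernel
        direction \<open>(k / A, b, -a)\<close> gives the single point \<open>(A / k, 1 / b, -1 / a)\<close>.\<close>
      have pt: "(\<exists>t. x = t * (A / k) \<and> y = t * (1 / b) \<and> z = t * (- 1 / a))"
        if T0: "?T (y*z) (z*x) (x*y) = 0" and xyz: "x \<noteq> 0" "y \<noteq> 0" "z \<noteq> 0" for x y z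
      proof -
        obtain s where s: "A * (y*z) = s * k" "z*x = s * b" "x*y = - s * a"
          using ker[OF T0] by blast
        have s0: "s \<noteq> 0" "k \<noteq> 0" "b \<noteq> 0" "a \<noteq> 0" using s xyz A by auto
        have "x*y*z / s * (A / k) = x * (A * (y*z)) / (s * k)" by simp
        moreover have "x*y*z / s * (1 / b) = y * (z*x) / (s * b)" by simp
        moreover have "x*y*z / s * (- 1 / a) = z * (x*y) / (- s * a)" by simp
        ultimately have "x*y*z / s * (A / k) = x" "x*y*z / s * (1 / b) = y" "x*y*z / s * (- 1 / a) = z"
          unfolding s using s0 by simp_all
        then show ?thesis by metis
      qed
      have "(y = 0 \<and> z = 0) \<or> (z = 0 \<and> x = 0) \<or> (x = 0 \<and> y = 0)
         \<or> (\<exists>t. x = t * (A / k) \<and> y = t * (1 / b) \<and> z = t * (- 1 / a))"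
        if T0: "?T (y*z) (z*x) (x*y) = 0" for x y z
      proof (cases "x = 0 \<or> y = 0 \<or> z = 0")
        case True
        then show ?thesis using coord[OF T0] by blast
      next
        case False
        then show ?thesis by (intro disjI2 pt T0) auto
      qed
      note pts = this
      show ?thesis
        by (rule disjI2, rule exI[of _ "A / k"], rule exI[of _ "1 / b"], rule exI[of _ "- 1 / a"],
            intro allI impI, rule pts)
    qed
  next
    assume *: "\<forall>x y. (A * B - G^2) * x^2 + 2 * (A * D - E * G) * x * y + (A * C - E^2) * y^2 = 0
      \<longrightarrow> x = 0 \<and> y = 0"
    have T2_0: "v = 0 \<and> w = 0" if "?T u v w = 0" for u v w
    proof -
      have "(A * u + G * v + E * w)^2 + T2 v w = 0" using sq[of u v w] that by simp
      then have "T2 v w = 0" using T2_nn[of v w] zero_le_power2[of "A * u + G * v + E * w"] by linarith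
      then show ?thesis unfolding T2_def by (rule *[rule_format])
    qed
    have "(y = 0 \<and> z = 0) \<or> (z = 0 \<and> x = 0) \<or> (x = 0 \<and> y = 0)" if "?T (y*z) (z*x) (x*y) = 0" for x y z
      using T2_0[OF that] coord[OF that] by (metis mult_eq_0_iff)
    note pts = this
    \<comment> \<open>A definite form leaves only the vertices; \<open>0\<close> fills the place of
      the fourth point.\<close>
    show ?thesis by (rule disjI2, (rule exI[of _ 0])+, intro allI impI) (use pts in blast)
  qed
qed

text \<open>Rotating the variables cyclically reduces \<open>B = 0\<close> and \<open>C = 0\<close>
  to the case \<open>A = 0\<close>, whence the three line cases.\<close>

lemma cremona_zeros:
  assumes P: "\<And>x y z. P x y z = ternary_form A B C D E G (y*z) (z*x) (x*y)"
    and nn: "\<And>x y z. 0 \<le> P x y z"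
  obtains (square) l m n where "\<And>x y z. P x y z = (l * (y*z) + m * (z*x) + n * (x*y))^2"
  | (points) a b c where "\<And>x y z. P x y z = 0 \<Longrightarrow>
         (y = 0 \<and> z = 0) \<or> (z = 0 \<and> x = 0) \<or> (x = 0 \<and> y = 0)
         \<or> (\<exists>t. x = t * a \<and> y = t * b \<and> z = t * c)"
  | (line_x) "\<And>x y z. P x y z = 0 \<Longrightarrow> x = 0 \<or> y = 0 \<and> z = 0"
  | (line_y) "\<And>x y z. P x y z = 0 \<Longrightarrow> y = 0 \<or> z = 0 \<and> x = 0"
  | (line_z) "\<And>x y z. P x y z = 0 \<Longrightarrow> z = 0 \<or> x = 0 \<and> y = 0"
proof -
  have T: "0 \<le> ternary_form A B C D E G u v w" for u v w
    using cremona_nonneg nn unfolding P .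
  have rot1: "ternary_form A B C D E G u v w = ternary_form B C A E G D v w u" for u v w
    by (simp add: ternary_form_def)
  have rot2: "ternary_form A B C D E G u v w = ternary_form C A B G D E w u v" for u v w
    by (simp add: ternary_form_def)
  show thesis
  proof (cases "A = 0 \<or> B = 0 \<or> C = 0")
    case True
    then consider "A = 0" | "B = 0" | "C = 0" by blast
    then show thesis
    proof cases
      case 1
      from cremona_zeros_degenerate[OF T 1] show thesis
      proof (elim disjE exE)
        fix l m n assume "\<forall>x y z. ternary_form A B C D E G (y*z) (z*x) (x*y) = (l * (y*z) + m * (z*x) + n * (x*y))^2"
        then show thesis unfolding P[symmetric] by (intro square[of l m n]) blast
      next
        assume "\<forall>x y z. ternary_form A B C D E G (y*z) (z*x) (x*y) = 0 \<longrightarrow> x = 0 \<or> y = 0 \<and> z = 0"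
        then show thesis unfolding P[symmetric] by (intro line_x) blast
      qed
    next
      case 2
      from cremona_zeros_degenerate[OF T[unfolded rot1] 2] show thesis
      proof (elim disjE exE)
        fix l m n assume *: "\<forall>x y z. ternary_form B C A E G D (y*z) (z*x) (x*y) = (l * (y*z) + m * (z*x) + n * (x*y))^2"
        show thesis by (rule square[of n l m]) (simp add: P rot1 *[rule_format, of y z x for y z x] add_ac)
      next
        assume *: "\<forall>x y z. ternary_form B C A E G D (y*z) (z*x) (x*y) = 0 \<longrightarrow> x = 0 \<or> y = 0 \<and> z = 0"
        show thesis
        proof (rule line_y)
          fix x y z assume "P x y z = 0"
          then show "y = 0 \<or> z = 0 \<and> x = 0" by (intro *[rule_format]) (simp only: P rot1)
        qed
      qed
    next
      case 3
      from cremona_zeros_degenerate[OF T[unfolded rot2] 3] show thesis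
      proof (elim disjE exE)
        fix l m n assume *: "\<forall>x y z. ternary_form C A B G D E (y*z) (z*x) (x*y) = (l * (y*z) + m * (z*x) + n * (x*y))^2"
        show thesis by (rule square[of m n l]) (simp add: P rot2 *[rule_format, of z x y for z x y] add_ac)
      next
        assume *: "\<forall>x y z. ternary_form C A B G D E (y*z) (z*x) (x*y) = 0 \<longrightarrow> x = 0 \<or> y = 0 \<and> z = 0"
        show thesis
        proof (rule line_z)
          fix x y z assume "P x y z = 0"
          then show "z = 0 \<or> x = 0 \<and> y = 0" by (intro *[rule_format]) (simp only: P rot2)
        qed
      qed
    qed
  next
    case False
    then have "A \<noteq> 0" "B \<noteq> 0" "C \<noteq> 0" by auto
    from cremona_zeros_nondegenerate[OF T this] show thesis
    proof (elim disjE exE)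
      fix l m n assume "\<forall>x y z. ternary_form A B C D E G (y*z) (z*x) (x*y) = (l * (y*z) + m * (z*x) + n * (x*y))^2"
      then show thesis unfolding P[symmetric] by (intro square[of l m n]) blast
    next
      fix a b c assume *: "\<forall>x y z. ternary_form A B C D E G (y*z) (z*x) (x*y) = 0 \<longrightarrow>
         (y = 0 \<and> z = 0) \<or> (z = 0 \<and> x = 0) \<or> (x = 0 \<and> y = 0)
         \<or> (\<exists>t. x = t * a \<and> y = t * b \<and> z = t * c)"
      show thesis by (rule points, rule *[rule_format]) (simp only: P)
    qed
  qed
qed

section \<open>Sums of fourth powers in a plane\<close>

lemma bquad_linear:
  "bquad (s *\<^sub>R g + t *\<^sub>R h) x y = s * bquad g x y + t * bquad h x y"
  by (cases g; cases h) (simp add: bquad_def algebra_simps)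

lemma bquad_scale: "bquad (s *\<^sub>R g) x y = s * bquad g x y"
  by (cases g) (simp add: bquad_def algebra_simps)

lemma sum4_append: "sum4 (qs @ rs) x y = sum4 qs x y + sum4 rs x y"
  by (simp add: sum4_def)

lemma sum4_partition:
  "sum4 qs x y = sum4 (filter P qs) x y + sum4 (filter (\<lambda>q. \<not> P q) qs) x y"
  unfolding sum4_def by (induction qs) auto

lemma sum4_multiples:
  assumes "\<And>q. q \<in> set qs \<Longrightarrow> \<exists>t. q = t *\<^sub>R p"
  shows "\<exists>r. sum4 qs = sum4 [r]"
proof -
  have "\<exists>c\<ge>0. \<forall>x y. sum4 qs x y = c * bquad p x y ^ 4"
    using assms
  proof (induction qs)
    case Nil
    show ?case by (auto simp: sum4_def)
  next
    case (Cons q qs)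
    obtain t where t: "q = t *\<^sub>R p" using Cons.prems[of q] by auto
    obtain c where c: "0 \<le> c" "\<forall>x y. sum4 qs x y = c * bquad p x y ^ 4"
      using Cons.IH Cons.prems by (meson list.set_intros(2))
    have "sum4 (q # qs) x y = (t ^ 4 + c) * bquad p x y ^ 4" for x y
      using c(2)[rule_format, of x y]
      by (simp add: sum4_def t bquad_scale power_mult_distrib algebra_simps)
    then show ?case using c(1) by (intro exI[of _ "t ^ 4 + c"]) auto
  qed
  then obtain c where c: "0 \<le> c" "\<forall>x y. sum4 qs x y = c * bquad p x y ^ 4" by blast
  have "sum4 qs = sum4 [root 4 c *\<^sub>R p]"
    using c by (auto simp: fun_eq_iff sum4_def bquad_scale power_mult_distrib)
  then show ?thesis by blast
qed

text \<open>All terms on one line through the origin merge into a single fourth power, so each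
  listed point costs one term.\<close>

lemma sum4_points:
  assumes "\<And>q. q \<in> set qs \<Longrightarrow> \<exists>p\<in>set ps. \<exists>t. q = t *\<^sub>R p"
  shows "\<exists>rs. length rs = length ps \<and> sum4 rs = sum4 qs"
  using assms
proof (induction ps arbitrary: qs)
  case Nil
  then show ?case by (cases qs) auto
next
  case (Cons p ps)
  define Q where "Q q \<longleftrightarrow> (\<exists>t. q = t *\<^sub>R p)" for q
  obtain r where r: "sum4 (filter Q qs) = sum4 [r]"
    using sum4_multiples[of "filter Q qs" p] by (auto simp: Q_def)
  obtain rs where rs: "length rs = length ps" "sum4 rs = sum4 (filter (\<lambda>q. \<not> Q q) qs)"
  proof -
    have "\<exists>p'\<in>set ps. \<exists>t. q = t *\<^sub>R p'" if "q \<in> set (filter (\<lambda>q. \<not> Q q) qs)" for q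
      using Cons.prems[of q] that by (auto simp: Q_def)
    from Cons.IH[OF this] show ?thesis using that by blast
  qed
  have "sum4 (r # rs) = sum4 qs"
    using sum4_append[of "[r]" rs] sum4_partition[of qs _ _ Q] by (simp add: fun_eq_iff r rs)
  then show ?case using rs by (intro exI[of _ "r # rs"]) simp
qed

section \<open>Moments of binary quartics and Gauss quadrature\<close>

definition moment :: "(real \<times> real) list \<Rightarrow> nat \<Rightarrow> real" where
  "moment ps k = (\<Sum>(s, t)\<leftarrow>ps. s ^ (4 - k) * t ^ k)"

text \<open>The right-hand side is the Hankel form of the five moments at \<open>(a, b, c)\<close>,
  which is therefore positive semidefinite.\<close>

lemma moment_square:
  "(\<Sum>(s, t)\<leftarrow>ps. (a * s^2 + b * s * t + c * t^2)^2)
    = a^2 * moment ps 0 + 2 * a * b * moment ps 1 + (2 * a * c + b^2) * moment ps 2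
      + 2 * b * c * moment ps 3 + c^2 * moment ps 4"
  by (induction ps) (auto simp: moment_def power2_eq_square power3_eq_cube power4_eq_xxxx algebra_simps)

lemma moment_square_nonneg:
  "0 \<le> a^2 * moment ps 0 + 2 * a * b * moment ps 1 + (2 * a * c + b^2) * moment ps 2
      + 2 * b * c * moment ps 3 + c^2 * moment ps 4"
  unfolding moment_square[symmetric] by (intro sum_list_nonneg) auto

text \<open>The sum depends on the coefficients of the terms only through five moments. If the
  leading 2 by 2 Hankel block is singular, the terms lie on two lines; otherwise three quadrature
  nodes reproduce the moments.\<close>

lemma sum4_plane:
  assumes "\<And>q. q \<in> set qs \<Longrightarrow> \<exists>s t. q = s *\<^sub>R g + t *\<^sub>R h"
  shows "\<exists>rs. length rs \<le> 3 \<and> sum4 rs = sum4 qs"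
proof -
  have "\<forall>q\<in>set qs. \<exists>p. q = (\<lambda>(s, t). s *\<^sub>R g + t *\<^sub>R h) p" using assms by fastforce
  then obtain ps where qs: "qs = map (\<lambda>(s, t). s *\<^sub>R g + t *\<^sub>R h) ps"
    unfolding ex_map_conv[symmetric] by blast
  define m where "m = moment ps"
  note defs = m_def[symmetric]
  have sum_qs: "sum4 qs x y = m 0 * bquad g x y ^ 4 + 4 * m 1 * bquad g x y ^ 3 * bquad h x y
      + 6 * m 2 * bquad g x y ^ 2 * bquad h x y ^ 2 + 4 * m 3 * bquad g x y * bquad h x y ^ 3
      + m 4 * bquad h x y ^ 4" for x y
    unfolding qs m_def
    by (induction ps)
      (auto simp: sum4_def moment_def bquad_linear power2_eq_square power3_eq_cube power4_eq_xxxx algebra_simps)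
  have psd: "0 \<le> m 0 * a^2 + 2 * m 1 * a * b + m 2 * b^2" for a b
    using moment_square_nonneg[of a ps b 0] by (simp add: defs mult_ac)
  from nonneg_binary_quadratic[OF psd] show ?thesis
  proof (elim disjE exE)
    fix \<alpha> \<beta> assume sq: "\<forall>x y. m 0 * x^2 + 2 * m 1 * x * y + m 2 * y^2 = (\<alpha> * x + \<beta> * y)^2"
    \<comment> \<open>An isotropic vector of the Hankel block: \<open>s * (a * s + b * t)\<close>
      then vanishes at every point, which puts each term on the line of \<open>h\<close> or of
      \<open>b *\<^sub>R g - a *\<^sub>R h\<close>.\<close>
    obtain a b where ab: "a \<noteq> 0 \<or> b \<noteq> 0" "m 0 * a^2 + 2 * m 1 * a * b + m 2 * b^2 = 0"
    proof (cases "\<alpha> = 0 \<and> \<beta> = 0")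
      case True
      then show ?thesis using that[of 1 0] sq[rule_format, of 1 0] by simp
    next
      case False
      then show ?thesis using that[of \<beta> "-\<alpha>"] sq[rule_format, of \<beta> "-\<alpha>"] by auto
    qed
    have "\<exists>p\<in>set [h, b *\<^sub>R g - a *\<^sub>R h]. \<exists>k. q = k *\<^sub>R p" if q: "q \<in> set qs" for q
    proof -
      obtain s t where st: "(s, t) \<in> set ps" "q = s *\<^sub>R g + t *\<^sub>R h" using q unfolding qs by auto
      have "(a * s^2 + b * s * t + 0 * t^2)^2 \<le> (\<Sum>(s, t)\<leftarrow>ps. (a * s^2 + b * s * t + 0 * t^2)^2)"
        by (rule member_le_sum_list) (use st in force)+
      also have "\<dots> = 0" unfolding moment_square defs using ab(2) by (simp add: mult_ac)
      finally have "a * s^2 + b * s * t + 0 * t^2 = 0" by simp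
      then have "s * (a * s + b * t) = 0" by (simp add: power2_eq_square algebra_simps)
      then consider "s = 0" | "a * s = - (b * t)" by force
      then show ?thesis
      proof cases
        case 1
        then show ?thesis using st by simp
      next
        case 2
        define n where "n = a^2 + b^2"
        have n: "n \<noteq> 0" using ab(1) by (simp add: n_def sum_power2_eq_zero_iff)
        have "n * s = b * (b * s - a * t)" "n * t = - a * (b * s - a * t)"
          using 2 by (simp_all add: n_def power2_eq_square algebra_simps)
        then have "s = (b * s - a * t) / n * b" "t = - ((b * s - a * t) / n * a)"
          using n by (simp_all add: field_simps)
        then obtain k where k: "s = k * b" "t = - (k * a)" by blast
        have "q = k *\<^sub>R (b *\<^sub>R g - a *\<^sub>R h)" by (simp add: st k scaleR_diff_right)
        then show ?thesis by auto
      qed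
    qed
    from sum4_points[of qs, OF this] obtain rs
      where "length rs = length [h, b *\<^sub>R g - a *\<^sub>R h]" "sum4 rs = sum4 qs" by blast
    then show ?thesis by (intro exI[of _ rs]) simp
  next
    assume def: "\<forall>x y. m 0 * x^2 + 2 * m 1 * x * y + m 2 * y^2 = 0 \<longrightarrow> x = 0 \<and> y = 0"
    have pos: "0 < m 0 * x^2 + 2 * m 1 * x * y + m 2 * y^2" if "x \<noteq> 0 \<or> y \<noteq> 0" for x y
      using psd[of x y] def that by (metis less_eq_real_def)
    have m0: "0 < m 0" using pos[of 1 0] by simp
    define D where "D = m 0 * m 2 - m 1 ^ 2"
    have "0 < m 0 * D" using pos[of "m 1" "- m 0"] m0
      by (simp add: D_def power2_eq_square algebra_simps)
    then have D: "0 < D" using m0 by (simp add: zero_less_mult_iff)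
    define \<alpha> where "\<alpha> = (m 0 * m 3 - m 1 * m 2) / D"
    define \<beta> where "\<beta> = (m 2 ^ 2 - m 1 * m 3) / D"
    text \<open>Gauss quadrature: \<open>x^2 - \<alpha> x - \<beta>\<close> is the second orthogonal polynomial, its roots are two
      of the nodes and the third node is at infinity.\<close>
    have m2: "m 2 = \<alpha> * m 1 + \<beta> * m 0"
    proof -
      have "D * (\<alpha> * m 1 + \<beta> * m 0) = (m 0 * m 3 - m 1 * m 2) * m 1 + (m 2 ^ 2 - m 1 * m 3) * m 0"
        using D by (simp add: \<alpha>_def \<beta>_def distrib_left)
      also have "\<dots> = D * m 2" by (simp add: D_def power2_eq_square algebra_simps)
      finally show ?thesis using D by simp
    qed
    have m3: "m 3 = \<alpha> * m 2 + \<beta> * m 1"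
    proof -
      have "D * (\<alpha> * m 2 + \<beta> * m 1) = (m 0 * m 3 - m 1 * m 2) * m 2 + (m 2 ^ 2 - m 1 * m 3) * m 1"
        using D by (simp add: \<alpha>_def \<beta>_def distrib_left)
      also have "\<dots> = D * m 3" by (simp add: D_def power2_eq_square algebra_simps)
      finally show ?thesis using D by simp
    qed
    \<comment> \<open>The argument of \<open>pos\<close> encodes the derivative
      \<open>2 * x - \<alpha>\<close> of the orthogonal polynomial; positivity makes its roots real
      and distinct.\<close>
    have "0 < m 0 * (\<alpha>^2 + 4 * \<beta>)" using pos[of "- \<alpha>" 2] m2
      by (simp add: power2_eq_square algebra_simps)
    then have disc: "0 < \<alpha>^2 + 4 * \<beta>" using m0 by (simp add: zero_less_mult_iff)
    define d where "d = sqrt (\<alpha>^2 + 4 * \<beta>)"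
    have d: "0 < d" "d^2 = \<alpha>^2 + 4 * \<beta>" using disc by (simp_all add: d_def)
    define \<rho> where "\<rho> = (\<alpha> + d) / 2"
    define \<sigma> where "\<sigma> = (\<alpha> - d) / 2"
    have \<alpha>: "\<alpha> = \<rho> + \<sigma>" and \<beta>: "\<beta> = - (\<rho> * \<sigma>)" and dd: "d = \<rho> - \<sigma>"
      using d(2) by (simp_all add: \<rho>_def \<sigma>_def field_simps power2_eq_square)
    \<comment> \<open>\<open>v\<close> and \<open>w\<close> solve the Vandermonde system for
      \<open>m 0\<close>, \<open>m 1\<close>. They are nonnegative because the Hankel block is,
      evaluated at the linear factors of the orthogonal polynomial.\<close>
    define v where "v = (m 1 - \<sigma> * m 0) / d"
    define w where "w = (\<rho> * m 0 - m 1) / d"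
    \<comment> \<open>The weight at infinity corrects \<open>m 4\<close> alone. It equals the sum of
      squares of the orthogonal polynomial over the points, hence is nonnegative.\<close>
    define \<delta> where "\<delta> = m 4 - \<alpha> * m 3 - \<beta> * m 2"
    have "0 \<le> d * (m 1 - \<sigma> * m 0)" using psd[of "- \<sigma>" 1] m2
      by (simp add: dd \<alpha> \<beta> power2_eq_square algebra_simps)
    then have v0: "0 \<le> v" using d(1) by (simp add: v_def zero_le_mult_iff)
    have "0 \<le> d * (\<rho> * m 0 - m 1)" using psd[of "- \<rho>" 1] m2
      by (simp add: dd \<alpha> \<beta> power2_eq_square algebra_simps)
    then have w0: "0 \<le> w" using d(1) by (simp add: w_def zero_le_mult_iff)
    have "0 \<le> \<beta>^2 * m 0 + 2 * \<beta> * \<alpha> * m 1 + (\<alpha>^2 - 2 * \<beta>) * m 2 - 2 * \<alpha> * m 3 + m 4"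
      using moment_square_nonneg[of "-\<beta>" ps "-\<alpha>" 1] by (simp add: defs)
    also have "\<dots> = \<delta> + \<beta> * (\<alpha> * m 1 + \<beta> * m 0 - m 2) + \<alpha> * (\<alpha> * m 2 + \<beta> * m 1 - m 3)"
      by (simp add: \<delta>_def power2_eq_square algebra_simps)
    also have "\<dots> = \<delta>" using m2 m3 by simp
    finally have \<delta>0: "0 \<le> \<delta>" .
    have e0: "v + w = m 0"
    proof -
      have "v + w = (\<rho> - \<sigma>) * m 0 / d" by (simp add: v_def w_def add_divide_distrib[symmetric] algebra_simps)
      then show ?thesis using d(1) dd by simp
    qed
    have e1: "v * \<rho> + w * \<sigma> = m 1"
    proof -
      have "v * \<rho> + w * \<sigma> = (\<rho> - \<sigma>) * m 1 / d" by (simp add: v_def w_def add_divide_distrib[symmetric] algebra_simps)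
      then show ?thesis using d(1) dd by simp
    qed
    \<comment> \<open>\<rho> and \<sigma> are the roots of
      \<open>x^2 = \<alpha> * x + \<beta>\<close>, so the moments of the nodes obey the recurrence
      found in \<open>m2\<close> and \<open>m3\<close>.\<close>
    have rec: "v * \<rho> ^ (k + 2) + w * \<sigma> ^ (k + 2)
        = \<alpha> * (v * \<rho> ^ (k + 1) + w * \<sigma> ^ (k + 1)) + \<beta> * (v * \<rho> ^ k + w * \<sigma> ^ k)" for k
      by (simp add: \<alpha> \<beta> power2_eq_square algebra_simps)
    have e2: "v * \<rho> ^ 2 + w * \<sigma> ^ 2 = m 2" using rec[of 0] e0 e1 m2 by (simp add: numeral_2_eq_2)
    have e3: "v * \<rho> ^ 3 + w * \<sigma> ^ 3 = m 3" using rec[of 1] e1 e2 m3 by (simp add: numeral_3_eq_3 numeral_2_eq_2)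
    have "v * \<rho> ^ 4 + w * \<sigma> ^ 4 = \<alpha> * (v * \<rho> ^ 3 + w * \<sigma> ^ 3) + \<beta> * (v * \<rho> ^ 2 + w * \<sigma> ^ 2)"
      using rec[of 2] by simp
    then have e4: "v * \<rho> ^ 4 + w * \<sigma> ^ 4 + \<delta> = m 4" unfolding e2 e3 by (simp add: \<delta>_def)
    have "sum4 [root 4 v *\<^sub>R (g + \<rho> *\<^sub>R h), root 4 w *\<^sub>R (g + \<sigma> *\<^sub>R h), root 4 \<delta> *\<^sub>R h] x y = sum4 qs x y" for x y
    proof -
      have "sum4 [root 4 v *\<^sub>R (g + \<rho> *\<^sub>R h), root 4 w *\<^sub>R (g + \<sigma> *\<^sub>R h), root 4 \<delta> *\<^sub>R h] x y
        = v * (bquad g x y + \<rho> * bquad h x y) ^ 4 + w * (bquad g x y + \<sigma> * bquad h x y) ^ 4 + \<delta> * bquad h x y ^ 4"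
        using v0 w0 \<delta>0 bquad_linear[of 1 g _ h]
        by (simp add: sum4_def bquad_scale power_mult_distrib)
      also have "\<dots> = sum4 qs x y"
        unfolding sum_qs e0[symmetric] e1[symmetric] e2[symmetric] e3[symmetric] e4[symmetric]
        by (simp add: power2_eq_square power3_eq_cube power4_eq_xxxx algebra_simps)
      finally show ?thesis .
    qed
    then show ?thesis
      by (intro exI[of _ "[root 4 v *\<^sub>R (g + \<rho> *\<^sub>R h), root 4 w *\<^sub>R (g + \<sigma> *\<^sub>R h), root 4 \<delta> *\<^sub>R h]"])
        (simp add: fun_eq_iff)
  qed
qed

section \<open>Sums of fourth powers of binary quadratics\<close>

text \<open>The nine coefficients of \<open>q^4\<close> as an octic, followed by the objective \<open>- disc(q)^2\<close>.\<close>

definition lift :: "real \<times> real \<times> real \<Rightarrow> real \<times> real \<times> real \<times> real \<times> real \<times> real \<times> real \<times> real \<times> real \<times> real" where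
  "lift q = (case q of (a, b, c) \<Rightarrow>
     (a^4, 4 * a^3 * b, 4 * a^3 * c + 6 * a^2 * b^2, 12 * a^2 * b * c + 4 * a * b^3, 6 * a^2 * c^2 + 12 * a * b^2 * c + b^4,
      12 * a * b * c^2 + 4 * b^3 * c, 4 * a * c^3 + 6 * b^2 * c^2, 4 * b * c^3, c^4, - ((b^2 - 4 * a * c)^2)))"

lemma bquad_power4_lift:
  "bquad q x y ^ 4 = (x^8, x^7 * y, x^6 * y^2, x^5 * y^3, x^4 * y^4, x^3 * y^5, x^2 * y^6, x * y^7, y^8, 0) \<bullet> lift q"
  by (cases q) (simp add: bquad_def lift_def inner_prod_def power2_eq_square power3_eq_cube power4_eq_xxxx
      eval_nat_numeral algebra_simps)

lemma lift_scaleR: "lift (t *\<^sub>R q) = t ^ 4 *\<^sub>R lift q"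
  by (cases q) (simp add: lift_def power2_eq_square power3_eq_cube power4_eq_xxxx algebra_simps)

lemma continuous_on_lift: "continuous_on UNIV lift"
proof -
  have "lift = (\<lambda>q. case (fst q, fst (snd q), snd (snd q)) of (a, b, c) \<Rightarrow>
     (a^4, 4 * a^3 * b, 4 * a^3 * c + 6 * a^2 * b^2, 12 * a^2 * b * c + 4 * a * b^3, 6 * a^2 * c^2 + 12 * a * b^2 * c + b^4,
      12 * a * b * c^2 + 4 * b^3 * c, 4 * a * c^3 + 6 * b^2 * c^2, 4 * b * c^3, c^4, - ((b^2 - 4 * a * c)^2)))"
    by (simp add: fun_eq_iff lift_def)
  from this[unfolded prod.case] show ?thesis by (rule ssubst) (intro continuous_intros)
qed

text \<open>A strictly positive functional that ignores the objective, as duality requires. The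
  weights 40, 1, 40 on \<open>x^8\<close>, \<open>x^4 * y^4\<close>, \<open>y^8\<close> are large
  enough for an explicit sum of squares.\<close>

lemma lift_pos:
  assumes "q \<noteq> 0"
  shows "0 < (40, 0, 0, 0, 1, 0, 0, 0, 40, 0) \<bullet> lift q"
proof -
  obtain a b c where q: "q = (a, b, c)" by (cases q)
  have "(40, 0, 0, 0, 1, 0, 0, 0, 40, 0) \<bullet> lift q = 40 * a^4 + 6 * a^2 * c^2 + 12 * a * b^2 * c + b^4 + 40 * c^4"
    by (simp add: q lift_def inner_prod_def)
  also have "\<dots> = b^4 / 4 + 3 / 4 * (b^2 + 8 * a * c)^2 + 21 * (a^2 - c^2)^2 + (19 * a^4 + 19 * c^4)"
    by (simp add: power2_eq_square power4_eq_xxxx algebra_simps)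
  also have "\<dots> > 0"
  proof -
    have "0 \<le> (b^2 + 8 * a * c)^2" "0 \<le> (a^2 - c^2)^2" "0 \<le> a^4" "0 \<le> b^4" "0 \<le> c^4" by simp_all
    moreover have "0 < a^4 \<or> 0 < b^4 \<or> 0 < c^4" using assms q by (auto simp: zero_prod_def)
    ultimately show ?thesis by linarith
  qed
  finally show ?thesis .
qed

text \<open>The coefficients of \<open>q \<mapsto> l \<bullet> lift q\<close> in the order used by \<open>quartic3_eval\<close>.\<close>

definition dual_coeffs :: "real \<times> real \<times> real \<times> real \<times> real \<times> real \<times> real \<times> real \<times> real \<times> real \<Rightarrow> nat \<Rightarrow> real" where
  "dual_coeffs l = (case l of (l0, l1, l2, l3, l4, l5, l6, l7, l8, s) \<Rightarrow>
     (!) [l0, l4 - s, l8, 4 * l1, 4 * l2, 4 * l3, 4 * l5, 4 * l6, 4 * l7, 6 * l6, 6 * l4 - 16 * s, 6 * l2,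
          12 * l3, 12 * l4 + 8 * s, 12 * l5])"

lemma prod_cases10:
  obtains l0 l1 l2 l3 l4 l5 l6 l7 l8 l9 where "l = (l0, l1, l2, l3, l4, l5, l6, l7, l8, l9)"
  by (metis prod.exhaust)

lemma inner_lift: "l \<bullet> lift (a, b, c) = quartic3_eval (dual_coeffs l) a b c"
  by (cases l rule: prod_cases10) (simp add: dual_coeffs_def quartic3_eval_def lift_def inner_prod_def
      power2_eq_square power3_eq_cube power4_eq_xxxx algebra_simps)

text \<open>The ten entries of \<open>lift\<close> are linearly independent quartics. The
  coefficients of \<open>b^4\<close> and \<open>c^2 * a^2\<close> separate \<open>l4\<close> from
  \<open>s\<close>.\<close>

lemma inner_lift_nontrivial:
  assumes "\<And>q. l \<bullet> lift q = 0"
  shows "l = 0"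
proof -
  have z: "dual_coeffs l i = 0" if "i < 15" for i
    using quartic3_eval_eq_0[of "dual_coeffs l"] assms that by (simp add: inner_lift[symmetric])
  obtain l0 l1 l2 l3 l4 l5 l6 l7 l8 s where l: "l = (l0, l1, l2, l3, l4, l5, l6, l7, l8, s)"
    by (rule prod_cases10)
  have "l0 = 0" using z[of 0] by (simp add: l dual_coeffs_def)
  moreover have "l4 - s = 0" using z[of 1] by (simp add: l dual_coeffs_def)
  moreover have "l8 = 0" using z[of 2] by (simp add: l dual_coeffs_def)
  moreover have "l1 = 0" using z[of 3] by (simp add: l dual_coeffs_def)
  moreover have "l2 = 0" using z[of 4] by (simp add: l dual_coeffs_def)
  moreover have "l3 = 0" using z[of 5] by (simp add: l dual_coeffs_def)
  moreover have "l5 = 0" using z[of 6] by (simp add: l dual_coeffs_def)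
  moreover have "l6 = 0" using z[of 7] by (simp add: l dual_coeffs_def)
  moreover have "l7 = 0" using z[of 8] by (simp add: l dual_coeffs_def)
  moreover have "6 * l4 - 16 * s = 0" using z[of 10] by (simp add: l dual_coeffs_def)
  ultimately show ?thesis by (simp add: l zero_prod_def)
qed

text \<open>Excludes the case where \<open>P\<close> is the square of a conic through three independent points.\<close>

lemma inner_lift_square:
  fixes l :: "real \<times> real \<times> real \<times> real \<times> real \<times> real \<times> real \<times> real \<times> real \<times> real"
  assumes sgn: "0 \<le> l \<bullet> (0, 0, 0, 0, 0, 0, 0, 0, 0, 1)"
    and sq: "\<And>a b c. l \<bullet> lift (a, b, c) = (p * a^2 + r * b^2 + v * c^2 + 2 * u * (b * c) + 2 * t * (c * a) + 2 * q * (a * b))^2"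
    and z: "\<And>x. x \<in> S \<Longrightarrow> l \<bullet> lift x = 0" and S: "span S = UNIV"
  shows "l = 0"
proof -
  obtain l0 l1 l2 l3 l4 l5 l6 l7 l8 s where l: "l = (l0, l1, l2, l3, l4, l5, l6, l7, l8, s)"
    by (rule prod_cases10)
  have s: "0 \<le> s" using sgn by (simp add: l inner_prod_def)
  define k where "k = (!) [p^2, r^2, v^2, 4 * p * q, 4 * p * t, 4 * q * r, 4 * r * u, 4 * t * v, 4 * u * v,
     2 * r * v + 4 * u^2, 2 * p * v + 4 * t^2, 2 * p * r + 4 * q^2, 4 * p * u + 8 * q * t, 4 * t * r + 8 * q * u, 4 * q * v + 8 * t * u]"
  have "quartic3_eval k a b c = (p * a^2 + r * b^2 + v * c^2 + 2 * u * (b * c) + 2 * t * (c * a) + 2 * q * (a * b))^2" for a b c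
    by (simp add: k_def quartic3_eval_def power2_eq_square power3_eq_cube power4_eq_xxxx algebra_simps)
  then have "quartic3_eval (\<lambda>i. dual_coeffs l i - k i) a b c = 0" for a b c
    using sq[of a b c] unfolding inner_lift by (simp add: quartic3_eval_def algebra_simps)
  from quartic3_eval_eq_0[OF this] have "dual_coeffs l i = k i" if "i < 15" for i
    using that by simp
  note e = this[unfolded l dual_coeffs_def k_def, simplified]
  \<comment> \<open>Each of \<open>l2\<close>, \<open>l3\<close>, \<open>l5\<close>,
    \<open>l6\<close> occurs in two coefficients, and \<open>l4\<close> with \<open>s\<close> in
    three; eliminating the \<open>l\<close> entries leaves the six relations between the conic and
    \<open>s\<close>.\<close>
  have e': "l4 - s = r^2" "4 * l2 = 4 * p * t" "6 * l2 = 2 * p * r + 4 * q^2" "4 * l3 = 4 * q * r" "12 * l3 = 4 * p * u + 8 * q * t"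
    "4 * l5 = 4 * r * u" "12 * l5 = 4 * q * v + 8 * t * u" "4 * l6 = 4 * t * v" "6 * l6 = 2 * r * v + 4 * u^2"
    "6 * l4 - 16 * s = 2 * p * v + 4 * t^2" "12 * l4 + 8 * s = 4 * t * r + 8 * q * u"
    using e[of 1] e[of 4] e[of 11] e[of 5] e[of 12] e[of 6] e[of 14] e[of 7] e[of 9] e[of 10] e[of 13] by simp_all
  have rel: "p * r = q^2 \<and> p * t = q^2 \<and> p * v = t^2 \<and> r * v = u^2 \<and> t * v = u^2 \<and> p * u = q * t \<and> q * u = t * r
     \<and> q * v = u * t \<and> q * u = t^2 \<and> r = t"
    by (rule conic_square_relations_rank_one[OF s]) (use e' in \<open>simp_all add: mult_ac\<close>)
  have rows: "p * a + q * b + t * c = 0 \<and> q * a + r * b + u * c = 0 \<and> t * a + u * b + v * c = 0"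
    if "(a, b, c) \<in> S" for a b c
  proof -
    let ?c = "p * a^2 + r * b^2 + v * c^2 + 2 * u * (b * c) + 2 * t * (c * a) + 2 * q * (a * b)"
    have c: "?c = 0" using z[OF that] sq[of a b c] by simp
    \<comment> \<open>Up to a multiple of the conic, the square of each row is a combination of 2 by
      2 minors. These vanish, so every zero of the conic lies in the kernel of its matrix.\<close>
    have "(p * a + q * b + t * c)^2 - p * ?c
        = (q^2 - p * r) * b^2 + (t^2 - p * v) * c^2 + 2 * (q * t - p * u) * (b * c)"
      by (simp add: power2_eq_square algebra_simps)
    moreover have "(q * a + r * b + u * c)^2 - r * ?c
        = (q^2 - p * r) * a^2 + (u^2 - r * v) * c^2 + 2 * (q * u - t * r) * (a * c)"
      by (simp add: power2_eq_square algebra_simps)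
    moreover have "(t * a + u * b + v * c)^2 - v * ?c
        = (t^2 - p * v) * a^2 + (u^2 - r * v) * b^2 + 2 * (u * t - q * v) * (a * b)"
      by (simp add: power2_eq_square algebra_simps)
    ultimately show ?thesis unfolding c using rel by simp
  qed
  have rows_inner: "(p, q, t) \<bullet> x = 0 \<and> (q, r, u) \<bullet> x = 0 \<and> (t, u, v) \<bullet> x = 0" if "x \<in> S" for x
    using rows[of "fst x" "fst (snd x)" "snd (snd x)"] that by (simp add: inner_prod_def)
  \<comment> \<open>The zeros span the space, so rows orthogonal to all of them vanish and the conic
    is identically zero.\<close>
  have "w = 0" if w: "\<And>x. x \<in> S \<Longrightarrow> w \<bullet> x = 0" for w :: "real \<times> real \<times> real"
  proof -
    have "w \<bullet> w = 0" by (rule span_induct[of w S "\<lambda>x. w \<bullet> x = 0"])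
        (use w S in \<open>auto simp: subspace_def inner_add_right\<close>)
    then show ?thesis by simp
  qed
  then have "(p, q, t) = 0" "(q, r, u) = 0" "(t, u, v) = 0" using rows_inner by blast+
  then have "l \<bullet> lift (a, b, c) = 0" for a b c by (simp add: sq zero_prod_def)
  then show ?thesis by (intro inner_lift_nontrivial) (metis prod_cases3)
qed

text \<open>The final \<open>0\<close> forgets the objective: moving the lifted sum along the last
  basis vector keeps the octic.\<close>

lemma sum4_lift:
  "sum4 qs x y = (x^8, x^7 * y, x^6 * y^2, x^5 * y^3, x^4 * y^4, x^3 * y^5, x^2 * y^6, x * y^7, y^8, 0)
     \<bullet> sum_list (map lift qs)"
  by (induction qs) (simp_all add: sum4_def bquad_power4_lift inner_add_right del: inner_Pair)

section \<open>Upper bound: reduction to four terms\<close>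

lemma sum4_plane_and_point:
  assumes "\<And>q. q \<in> set qs \<Longrightarrow> (\<exists>s t. q = s *\<^sub>R g + t *\<^sub>R h) \<or> (\<exists>t. q = t *\<^sub>R p)"
  shows "\<exists>rs. length rs \<le> 4 \<and> sum4 rs = sum4 qs"
proof -
  define Q where "Q q \<longleftrightarrow> (\<exists>s t. q = s *\<^sub>R g + t *\<^sub>R h)" for q
  have "\<exists>s t. q = s *\<^sub>R g + t *\<^sub>R h" if "q \<in> set (filter Q qs)" for q
    using that by (simp add: Q_def)
  from sum4_plane[of "filter Q qs", OF this] obtain rs
    where rs: "length rs \<le> 3" "sum4 rs = sum4 (filter Q qs)" by blast
  have "\<exists>t. q = t *\<^sub>R p" if "q \<in> set (filter (\<lambda>q. \<not> Q q) qs)" for q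
    using assms[of q] that unfolding Q_def by auto
  from sum4_multiples[of "filter (\<lambda>q. \<not> Q q) qs", OF this] obtain r
    where r: "sum4 (filter (\<lambda>q. \<not> Q q) qs) = sum4 [r]" by blast
  have "sum4 (rs @ [r]) x y = sum4 qs x y" for x y
    using sum4_partition[of qs x y Q] by (simp add: sum4_append rs r)
  then show ?thesis using rs(1) by (intro exI[of _ "rs @ [r]"]) (simp add: fun_eq_iff)
qed

lemma sum4_length_le_4: "\<exists>rs. length rs \<le> 4 \<and> sum4 rs = sum4 qs"
proof (cases "\<forall>q\<in>set qs. q = 0")
  \<comment> \<open>Duality starts from a sum with positive value, so the zero octic is treated
    apart.\<close>
  case True
  then have "\<exists>t. q = t *\<^sub>R 0" if "q \<in> set qs" for q using that by simp
  from sum4_multiples[of qs, OF this] obtain r where "sum4 qs = sum4 [r]" by blast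
  then show ?thesis by (intro exI[of _ "[r]"]) simp
next
  case False
  let ?I = "(40, 0, 0, 0, 1, 0, 0, 0, 40, 0) :: real \<times> real \<times> real \<times> real \<times> real \<times> real \<times> real \<times> real \<times> real \<times> real"
  let ?e = "(0, 0, 0, 0, 0, 0, 0, 0, 0, 1) :: real \<times> real \<times> real \<times> real \<times> real \<times> real \<times> real \<times> real \<times> real \<times> real"
  have I_nonneg: "0 \<le> ?I \<bullet> lift q" for q
    using lift_pos[of q] lift_scaleR[of 0 q] by (cases "q = 0") (simp_all del: inner_Pair)
  have I_sum: "0 \<le> ?I \<bullet> sum_list (map lift us) \<and> ((\<exists>q\<in>set us. q \<noteq> 0) \<longrightarrow> 0 < ?I \<bullet> sum_list (map lift us))" for us
  proof (induction us)
    case Nil then show ?case by simp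
  next
    case (Cons q us)
    then show ?case using I_nonneg[of q] lift_pos[of q]
      by (auto simp add: inner_add_right simp del: inner_Pair intro: add_nonneg_pos add_pos_nonneg)
  qed
  have Iqs: "0 < ?I \<bullet> sum_list (map lift qs)" using I_sum False by blast
  have "?e \<noteq> 0" "?I \<bullet> ?e = 0" by (simp_all add: zero_prod_def)
  from sum_fourth_powers_exposed[OF continuous_on_lift lift_scaleR lift_pos this Iqs]
  obtain rs t l where rs: "sum_list (map lift rs) = sum_list (map lift qs) - t *\<^sub>R ?e"
    and l: "l \<noteq> 0" "0 \<le> l \<bullet> ?e" and nn: "\<And>q. 0 \<le> l \<bullet> lift q"
    and z: "\<And>q. q \<in> set rs \<Longrightarrow> l \<bullet> lift q = 0" by blast
  have "sum4 rs x y = sum4 qs x y" for x y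
    unfolding sum4_lift rs inner_diff_right by (simp add: inner_prod_def)
  then have sum_rs: "sum4 rs = sum4 qs" by (simp add: fun_eq_iff)
  have "\<exists>us. length us \<le> 4 \<and> sum4 us = sum4 rs"
  proof -
    \<comment> \<open>At most two independent terms span no more than a plane; three of them serve
      as coordinate points for the dual quartic.\<close>
    obtain B where B: "B \<subseteq> set rs" "independent B" "set rs \<subseteq> span B"
      using maximal_independent_subset by blast
    have finB: "finite B" and cardB: "card B \<le> 3"
      using independent_bound[OF B(2)] by auto
    show ?thesis
    proof (cases "card B = 3")
      case False
      then consider "card B = 0" | "card B = 1" | "card B = 2" using cardB by linarith
      then obtain g h where "B \<subseteq> {g, h}"
      proof cases
        case 1 then show ?thesis using finB that by auto
      next
        case 2
        then obtain x where "B = {x}" by (rule card_1_singletonE)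
        then show ?thesis using that[of x x] by simp
      next
        case 3
        then obtain x y where "B = {x, y}" unfolding card_2_iff by blast
        then show ?thesis using that[of x y] by simp
      qed
      then have "set rs \<subseteq> span {g, h}" using B(3) span_mono by blast
      then have "\<exists>s t. q = s *\<^sub>R g + t *\<^sub>R h" if "q \<in> set rs" for q
        using that span_breakdown_eq[of q g "{h}"] span_breakdown_eq[of _ h "{}"]
        by (auto simp: algebra_simps)
      from sum4_plane[of rs, OF this] obtain us where "length us \<le> 3" "sum4 us = sum4 rs" by blast
      then show ?thesis by (intro exI[of _ us]) simp
    next
      case True
      then obtain p1 p2 p3 where p: "B = {p1, p2, p3}" unfolding card_3_iff by blast
      have spanB: "span B = UNIV"
        using card_ge_dim_independent[of B UNIV] B(2) True by auto
      have comb: "\<exists>x y z. q = x *\<^sub>R p1 + y *\<^sub>R p2 + z *\<^sub>R p3" for q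
      proof -
        have "q \<in> span {p1, p2, p3}" using spanB p by simp
        then obtain x y z where "q - x *\<^sub>R p1 - y *\<^sub>R p2 - z *\<^sub>R p3 = 0"
          unfolding span_breakdown_eq span_empty by blast
        then have "q = x *\<^sub>R p1 + y *\<^sub>R p2 + z *\<^sub>R p3" by (simp add: algebra_simps)
        then show ?thesis by blast
      qed
      obtain x1 y1 z1 where c1: "(1, 0, 0) = x1 *\<^sub>R p1 + y1 *\<^sub>R p2 + z1 *\<^sub>R p3" using comb by blast
      obtain x2 y2 z2 where c2: "(0, 1, 0) = x2 *\<^sub>R p1 + y2 *\<^sub>R p2 + z2 *\<^sub>R p3" using comb by blast
      obtain x3 y3 z3 where c3: "(0, 0, 1) = x3 *\<^sub>R p1 + y3 *\<^sub>R p2 + z3 *\<^sub>R p3" using comb by blast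
      define P where "P x y z = l \<bullet> lift (x *\<^sub>R p1 + y *\<^sub>R p2 + z *\<^sub>R p3)" for x y z
      have P_nn: "0 \<le> P x y z" for x y z using nn by (simp add: P_def)
      have P_0: "P 1 0 0 = 0" "P 0 1 0 = 0" "P 0 0 1 = 0"
        using z B(1) by (auto simp: P_def p)
      obtain a1 a2 a3 b1 b2 b3 d1 d2 d3 where abd: "p1 = (a1, b1, d1)" "p2 = (a2, b2, d2)" "p3 = (a3, b3, d3)"
        by (metis prod_cases3)
      have "P = (\<lambda>x y z. quartic3_eval (dual_coeffs l) (x * a1 + y * a2 + z * a3) (x * b1 + y * b2 + z * b3) (x * d1 + y * d2 + z * d3))"
        by (simp add: fun_eq_iff P_def abd inner_lift)
      then have "quartic3 P" using quartic3_subst by simp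
      then obtain k where "P x y z = quartic3_eval k x y z" for x y z
        unfolding quartic3_def by auto
      from nonneg_quartic3_three_zeros[OF this P_nn P_0] obtain A B' C D E G
        where "\<And>x y z. P x y z = A * (y * z)^2 + B' * (z * x)^2 + C * (x * y)^2
          + 2 * D * (z * x) * (x * y) + 2 * E * (y * z) * (x * y) + 2 * G * (y * z) * (z * x)" by blast
      then have P_T: "P x y z = ternary_form A B' C D E G (y * z) (z * x) (x * y)" for x y z
        by (simp add: ternary_form_def)
      have rs_P: "\<exists>x y z. q = x *\<^sub>R p1 + y *\<^sub>R p2 + z *\<^sub>R p3 \<and> P x y z = 0" if "q \<in> set rs" for q
        using comb[of q] z[OF that] unfolding P_def by metis
      from P_T P_nn show ?thesis
      proof (cases rule: cremona_zeros)
        case (square f m n)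
        \<comment> \<open>Coordinates with respect to \<open>p1\<close>, \<open>p2\<close>,
          \<open>p3\<close>. They carry the conic back to the coefficients \<open>(a, b, c)\<close>,
          where \<open>inner_lift_square\<close> contradicts \<open>l \<noteq> 0\<close>.\<close>
        define X where "X a b c = a * x1 + b * x2 + c * x3" for a b c
        define Y where "Y a b c = a * y1 + b * y2 + c * y3" for a b c
        define Z where "Z a b c = a * z1 + b * z2 + c * z3" for a b c
        have coord: "(a, b, c) = X a b c *\<^sub>R p1 + Y a b c *\<^sub>R p2 + Z a b c *\<^sub>R p3" for a b c
        proof -
          have "(a, b, c) = a *\<^sub>R (1, 0, 0) + b *\<^sub>R (0, 1, 0) + c *\<^sub>R (0, 0, 1)" by simp
          also have "\<dots> = X a b c *\<^sub>R p1 + Y a b c *\<^sub>R p2 + Z a b c *\<^sub>R p3"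
            unfolding c1 c2 c3 X_def Y_def Z_def by (simp add: algebra_simps)
          finally show ?thesis .
        qed
        have "quadratic3 (\<lambda>a b c. f * (Y a b c * Z a b c) + m * (Z a b c * X a b c) + n * (X a b c * Y a b c))"
          unfolding X_def Y_def Z_def
          by (intro quadratic3_add quadratic3_cmult quadratic3_mult_linear)
        then obtain k :: "nat \<Rightarrow> real" where k: "\<And>a b c. f * (Y a b c * Z a b c) + m * (Z a b c * X a b c) + n * (X a b c * Y a b c) =
            k 0 * a^2 + k 1 * b^2 + k 2 * c^2 + k 3 * (b * c) + k 4 * (c * a) + k 5 * (a * b)"
          unfolding quadratic3_def by auto
        have "l = 0"
        proof (rule inner_lift_square[OF l(2) _ _ spanB])
          show "l \<bullet> lift (a, b, c) = (k 0 * a^2 + k 1 * b^2 + k 2 * c^2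
            + 2 * (k 3 / 2) * (b * c) + 2 * (k 4 / 2) * (c * a) + 2 * (k 5 / 2) * (a * b))^2" for a b c
          proof -
            have "l \<bullet> lift (a, b, c) = P (X a b c) (Y a b c) (Z a b c)"
              unfolding P_def coord[symmetric] ..
            then show ?thesis unfolding square k by simp
          qed
        qed (use z B(1) in blast)
        then show ?thesis using l(1) by simp
      next
        case (points a b c)
        let ?ps = "[p1, p2, p3, a *\<^sub>R p1 + b *\<^sub>R p2 + c *\<^sub>R p3]"
        have "\<exists>p\<in>set ?ps. \<exists>t. q = t *\<^sub>R p" if q: "q \<in> set rs" for q
        proof -
          obtain x y z where xyz: "q = x *\<^sub>R p1 + y *\<^sub>R p2 + z *\<^sub>R p3" "P x y z = 0" using rs_P[OF q] by blast
          from points[OF xyz(2)] show ?thesis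
          proof (elim disjE exE conjE)
            fix t assume "x = t * a" "y = t * b" "z = t * c"
            then have "q = t *\<^sub>R (a *\<^sub>R p1 + b *\<^sub>R p2 + c *\<^sub>R p3)" using xyz(1) by (simp add: scaleR_add_right)
            then show ?thesis by auto
          qed (use xyz(1) in auto)
        qed
        from sum4_points[of rs, OF this] obtain us where "length us = length ?ps" "sum4 us = sum4 rs" by blast
        then show ?thesis by (intro exI[of _ us]) simp
      next
        case line_x
        show ?thesis
        proof (rule sum4_plane_and_point)
          fix q assume "q \<in> set rs"
          then obtain x y z where xyz: "q = x *\<^sub>R p1 + y *\<^sub>R p2 + z *\<^sub>R p3" "P x y z = 0" using rs_P by blast
          from line_x[OF xyz(2)]
          have "q = y *\<^sub>R p2 + z *\<^sub>R p3 \<or> q = x *\<^sub>R p1" using xyz(1) by auto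
          then show "(\<exists>s t. q = s *\<^sub>R p2 + t *\<^sub>R p3) \<or> (\<exists>t. q = t *\<^sub>R p1)" by blast
        qed
      next
        case line_y
        show ?thesis
        proof (rule sum4_plane_and_point)
          fix q assume "q \<in> set rs"
          then obtain x y z where xyz: "q = x *\<^sub>R p1 + y *\<^sub>R p2 + z *\<^sub>R p3" "P x y z = 0" using rs_P by blast
          from line_y[OF xyz(2)]
          have "q = x *\<^sub>R p1 + z *\<^sub>R p3 \<or> q = y *\<^sub>R p2" using xyz(1) by auto
          then show "(\<exists>s t. q = s *\<^sub>R p1 + t *\<^sub>R p3) \<or> (\<exists>t. q = t *\<^sub>R p2)" by blast
        qed
      next
        case line_z
        show ?thesis
        proof (rule sum4_plane_and_point)
          fix q assume "q \<in> set rs"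
          then obtain x y z where xyz: "q = x *\<^sub>R p1 + y *\<^sub>R p2 + z *\<^sub>R p3" "P x y z = 0" using rs_P by blast
          from line_z[OF xyz(2)]
          have "q = x *\<^sub>R p1 + y *\<^sub>R p2 \<or> q = z *\<^sub>R p3" using xyz(1) by auto
          then show "(\<exists>s t. q = s *\<^sub>R p1 + t *\<^sub>R p2) \<or> (\<exists>t. q = t *\<^sub>R p3)" by blast
        qed
      qed
    qed
  qed
  then show ?thesis unfolding sum_rs .
qed

section \<open>Lower bound: an octic that is not a sum of two fourth powers\<close>

lemma octic_needs_three: "\<not> sum4_len 2 (sum4 [(1, 0, 0), (0, 1, 0), (1, 1, 0)])"
proof
  assume "sum4_len 2 (sum4 [(1, 0, 0), (0, 1, 0), (1, 1, 0)])"
  then obtain qs where len: "length qs \<le> 2" and eq: "sum4 [(1, 0, 0), (0, 1, 0), (1, 1, 0)] = sum4 qs"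
    unfolding sum4_len_def by blast
  have "\<exists>p q. sum4 qs = sum4 [p, q]"
  proof -
    consider "qs = []" | p where "qs = [p]" | p q where "qs = [p, q]"
      using len by (cases qs; cases "tl qs"; cases "tl (tl qs)") auto
    then show ?thesis
    proof cases
      case 1 then show ?thesis by (intro exI[of _ "(0, 0, 0)"]) (simp add: sum4_def bquad_def)
    next
      case (2 p) then show ?thesis by (intro exI[of _ p] exI[of _ "(0, 0, 0)"]) (simp add: sum4_def bquad_def)
    qed blast
  qed
  then obtain a b c a' b' c' where eq': "sum4 qs = sum4 [(a, b, c), (a', b', c')]" by (metis prod_cases3)
  have e: "x^8 + (x * y)^4 + (x^2 + x * y)^4 = (a * x^2 + b * x * y + c * y^2)^4 + (a' * x^2 + b' * x * y + c' * y^2)^4" for x y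
    using fun_cong[OF fun_cong[OF eq[unfolded eq'], of x], of y]
    by (simp add: sum4_def bquad_def power_mult_distrib)
  \<comment> \<open>The octic has no \<open>y^8\<close> term, so both quadratics are divisible by
    \<open>x\<close>. Cancelling \<open>x^4\<close> leaves a binary quartic as a sum of two fourth
    powers of linear forms.\<close>
  have "c^4 + c'^4 = 0" using e[of 0 1] by simp
  moreover have "0 \<le> c^4" "0 \<le> c'^4" by simp_all
  ultimately have c: "c = 0" "c' = 0" by (simp_all add: add_nonneg_eq_0_iff)
  have e1: "1 + y^4 + (1 + y)^4 = (a + b * y)^4 + (a' + b' * y)^4" for y
    using e[of 1 y] by (simp add: c)
  define m0 m1 m2 m3 m4 where m: "m0 = a^4 + a'^4" "m1 = a^3 * b + a'^3 * b'" "m2 = a^2 * b^2 + a'^2 * b'^2"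
    "m3 = a * b^3 + a' * b'^3" "m4 = b^4 + b'^4"
  have e2: "1 + y^4 + (1 + y)^4 = m0 + 4 * m1 * y + 6 * m2 * y^2 + 4 * m3 * y^3 + m4 * y^4" for y
    unfolding e1 m by (simp add: power2_eq_square power3_eq_cube power4_eq_xxxx algebra_simps)
  have "m0 = 2" "m1 = 1" "m2 = 1" "m3 = 1" "m4 = 2"
    using e2[of 0] e2[of 1] e2[of "-1"] e2[of 2] e2[of "-2"] by simp_all
  \<comment> \<open>The catalecticant determinant vanishes for two fourth powers, whereas the
    moments 2, 1, 1, 1, 2 give the value 1.\<close>
  moreover have "m0 * (m2 * m4 - m3^2) - m1 * (m1 * m4 - m3 * m2) + m2 * (m1 * m3 - m2^2) = 0"
    unfolding m by (simp add: power2_eq_square power3_eq_cube power4_eq_xxxx algebra_simps)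
  ultimately show False by simp
qed

theorem mainTheorem14:
  shows "p4_2_8 \<in> {3, 4}"
proof -
  have 4: "\<forall>f\<in>Sigma4_2_8. sum4_len 4 f"
  proof
    fix f assume "f \<in> Sigma4_2_8"
    then obtain qs where "f = sum4 qs" unfolding Sigma4_2_8_def by blast
    then show "sum4_len 4 f" unfolding sum4_len_def using sum4_length_le_4[of qs] by metis
  qed
  then have "p4_2_8 \<le> 4" unfolding p4_2_8_def by (rule Least_le)
  moreover have "\<forall>f\<in>Sigma4_2_8. sum4_len p4_2_8 f" unfolding p4_2_8_def using 4 by (rule LeastI)
  then have "sum4_len p4_2_8 (sum4 [(1, 0, 0), (0, 1, 0), (1, 1, 0)])" unfolding Sigma4_2_8_def by blast
  then have "\<not> p4_2_8 \<le> 2" using octic_needs_three unfolding sum4_len_def by (metis le_trans)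
  ultimately show ?thesis by auto
qed

end
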